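(* Let $\mathbb{K}$ be a local field (Archimedean or non-Archimedean), let $G = \mathbf{G}(\mathbb{K})$, where $\mathbf{G}$ is a connected adjoint simple algebraic $\mathbb{K}$-group, let $\Gamma$ be a group, and let $f \colon \Gamma \to G$ be a quasihomomorphism. If $f(\Gamma)$ is unbounded in $G$ and generates a Zariski-dense subgroup of $G$, then $f$ is a homomorphism.
   Context: $G = \mathbf{G}(\mathbb{K})$ carries the locally compact topology coming from $\mathbb{K}$. A subset of a locally compact group is bounded if it is contained in a compact subset. A map $f \colon \Gamma \to G$ from an abstract group $\Gamma$ is a quasihomomorphism if its defect set $D_f = \{ f(y)^{-1} f(x)^{-1} f(xy) \mid x,y \in \Gamma\}$ is bounded in $G$. *)

theory Defs
  imports
    "HOL-Analysis.Analysis"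
    "HOL-Library.Poly_Mapping"
    "HOL-Algebra.Solvable_Groups"
    "HOL-Algebra.Algebraic_Closure_Type"
begin

unbundle no fps_syntax

section \<open>Local fields\<close>

text \<open>
  A local field is a non-discrete locally compact Hausdorff topological field. This covers the
  Archimedean fields and the non-Archimedean ones, in every characteristic.
\<close>

class local_field =
  field + t2_space + perfect_space + topological_ab_group_add + topological_semigroup_mult +
  assumes tendsto_inverse_nhds: "x \<noteq> 0 \<Longrightarrow> (inverse \<longlongrightarrow> inverse x) (nhds x)"
    and locally_compact_zero: "\<exists>U C. open U \<and> 0 \<in> U \<and> U \<subseteq> C \<and> compact C"

instance real :: local_field
proof
  fix x :: real assume "x \<noteq> 0"
  then show "(inverse \<longlongrightarrow> inverse x) (nhds x)"
    by (intro tendsto_inverse) (simp_all add: filterlim_ident)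
next
  show "\<exists>U C. open U \<and> (0::real) \<in> U \<and> U \<subseteq> C \<and> compact C"
    by (intro exI[of _ "ball 0 1"] exI[of _ "cball 0 1"]) auto
qed

instance complex :: local_field
proof
  fix x :: complex assume "x \<noteq> 0"
  then show "(inverse \<longlongrightarrow> inverse x) (nhds x)"
    by (intro tendsto_inverse) (simp_all add: filterlim_ident)
next
  show "\<exists>U C. open U \<and> (0::complex) \<in> U \<and> U \<subseteq> C \<and> compact C"
    by (intro exI[of _ "ball 0 1"] exI[of _ "cball 0 1"]) auto
qed


section \<open>Polynomials in the entries of a matrix\<close>

type_synonym ('a, 'n) matrix_poly = "('n \<times> 'n \<Rightarrow>\<^sub>0 nat) \<Rightarrow>\<^sub>0 'a"

text \<open>
  Value at the matrix \<open>A\<close> with entries in a commutative \<open>'a\<close>-algebra \<open>'b\<close>, whose structure map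
  is \<open>h\<close>.
\<close>

definition eval_at :: "('a::zero \<Rightarrow> 'b::comm_semiring_1) \<Rightarrow> 'b^'n^'n \<Rightarrow> ('a, 'n) matrix_poly \<Rightarrow> 'b"
  where "eval_at h A p =
    (\<Sum>m\<in>Poly_Mapping.keys p. h (Poly_Mapping.lookup p m) *
      (\<Prod>(i, j)\<in>Poly_Mapping.keys m. (A $ i $ j) ^ Poly_Mapping.lookup m (i, j)))"

definition vanishing_ideal :: "('a::comm_semiring_1^'n^'n) set \<Rightarrow> ('a, 'n) matrix_poly set"
  where "vanishing_ideal S = {p. \<forall>A\<in>S. eval_at id A p = 0}"


section \<open>Linear algebraic groups\<close>

text \<open>
  A linear algebraic \<open>K\<close>-group is taken in the sense of Borel: a Zariski-closed subgroup
  of \<open>GL\<^sub>n\<close> over the algebraic closure of \<open>K\<close>, defined over \<open>K\<close>. In the language of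
  schemes these are the smooth affine \<open>K\<close>-groups of finite type.
\<close>

definition matrix_group :: "('a::semiring_1^'n^'n) set \<Rightarrow> ('a^'n^'n) monoid"
  where "matrix_group S = \<lparr>carrier = S, mult = (**), one = mat 1\<rparr>"

text \<open>The principal open sets form a basis of the Zariski topology of \<open>GL\<^sub>n\<close>.\<close>

definition zariski_GL :: "('a::field^'n^'n) topology"
  where "zariski_GL =
    topology_generated_by (range (\<lambda>p. {A. invertible A \<and> eval_at id A p \<noteq> 0}))"

definition linear_algebraic_group :: "('a::field^'n^'n) set \<Rightarrow> bool"
  where "linear_algebraic_group G \<longleftrightarrow>
    subgroup G (matrix_group {A. invertible A}) \<and> closedin zariski_GL G"

text \<open>
  The ideal of \<open>G\<close> is generated by polynomials over \<open>K\<close>. For imperfect \<open>K\<close> this is stronger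
  than \<open>G\<close> being the zero set of polynomials over \<open>K\<close>.
\<close>

definition defined_over_base :: "('k::field alg_closure^'n^'n) set \<Rightarrow> bool"
  where "defined_over_base G \<longleftrightarrow>
    vanishing_ideal G =
      module.span (*) (vanishing_ideal G \<inter> range (Poly_Mapping.map (to_ac :: 'k \<Rightarrow> _)))"

definition algebraic_K_group :: "('k::field alg_closure^'n^'n) set \<Rightarrow> bool"
  where "algebraic_K_group G \<longleftrightarrow> linear_algebraic_group G \<and> defined_over_base G"

text \<open>The radical of \<open>G\<close> is trivial.\<close>

definition semisimple_group :: "('a::alg_closed_field^'n^'n) set \<Rightarrow> bool"
  where "semisimple_group G \<longleftrightarrow>
    linear_algebraic_group G \<and> connectedin zariski_GL G \<and>
    (\<forall>R. linear_algebraic_group R \<and> connectedin zariski_GL R \<and>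
         R \<lhd> matrix_group G \<and> solvable (matrix_group R) \<longrightarrow> R = {mat 1})"

text \<open>
  Simplicity is meant over \<open>K\<close>, so \<open>G\<close> need not remain simple over the algebraic closure.
\<close>

definition simple_K_group :: "('k::field alg_closure^'n^'n) set \<Rightarrow> bool"
  where "simple_K_group G \<longleftrightarrow>
    algebraic_K_group G \<and> semisimple_group G \<and> G \<noteq> {mat 1} \<and>
    (\<forall>N. algebraic_K_group N \<and> N \<lhd> matrix_group G \<longrightarrow> N = {mat 1} \<or> N = G)"


section \<open>The adjoint representation\<close>

text \<open>
  The Lie algebra is the tangent space at the identity: \<open>Y\<close> belongs to it iff \<open>1 + t Y\<close>
  satisfies the equations of \<open>G\<close> modulo \<open>t\<^sup>2\<close>.
\<close>

definition lie_algebra :: "('a::field^'n^'n) set \<Rightarrow> ('a^'n^'n) set"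
  where "lie_algebra G =
    {Y. \<forall>p\<in>vanishing_ideal G.
          Polynomial.coeff
            (eval_at (\<lambda>c. [:c:]) (\<chi> i j. [:(mat 1 :: 'a^'n^'n) $ i $ j, Y $ i $ j:]) p) 1 = 0}"

definition Ad :: "'a::field^'n^'n \<Rightarrow> 'a^'n^'n \<Rightarrow> 'a^'n^'n"
  where "Ad A Y = A ** Y ** matrix_inv A"

definition regular_function_on :: "('a::field^'n^'n) set \<Rightarrow> ('a^'n^'n \<Rightarrow> 'a) \<Rightarrow> bool"
  where "regular_function_on G \<phi> \<longleftrightarrow>
    (\<exists>p m. \<forall>A\<in>G. \<phi> A = eval_at id A p / det A ^ m)"

text \<open>
  The pullbacks along \<open>Ad\<close> of the regular functions on the general linear group of the Lie
  algebra \<open>\<g>\<close>: those functions form the algebra generated by the matrix coefficients of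
  an automorphism of \<open>\<g>\<close> and of its inverse.
\<close>

inductive_set Ad_regular_functions :: "('a::field^'n^'n) set \<Rightarrow> ('a^'n^'n \<Rightarrow> 'a) set"
  for G where
  const: "(\<lambda>A. c) \<in> Ad_regular_functions G"
| coeff: "Y \<in> lie_algebra G \<Longrightarrow> (\<lambda>A. Ad A Y $ i $ j) \<in> Ad_regular_functions G"
| coeff_inv: "Y \<in> lie_algebra G \<Longrightarrow> (\<lambda>A. Ad (matrix_inv A) Y $ i $ j) \<in> Ad_regular_functions G"
| add: "\<phi> \<in> Ad_regular_functions G \<Longrightarrow> \<psi> \<in> Ad_regular_functions G \<Longrightarrow>
    (\<lambda>A. \<phi> A + \<psi> A) \<in> Ad_regular_functions G"
| mult: "\<phi> \<in> Ad_regular_functions G \<Longrightarrow> \<psi> \<in> Ad_regular_functions G \<Longrightarrow>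
    (\<lambda>A. \<phi> A * \<psi> A) \<in> Ad_regular_functions G"

text \<open>
  A semisimple group is adjoint if \<open>Ad\<close> is an isomorphism of algebraic groups onto its image,
  that is, a closed immersion \<open>G \<rightarrow> GL(\<g>)\<close>: every regular function on \<open>G\<close> is pulled back from
  \<open>GL(\<g>)\<close>. Injectivity of \<open>Ad\<close> on points would be too weak in positive characteristic:
  \<open>SL\<^sub>p\<close> in characteristic \<open>p\<close> has no nontrivial central point, but it is not adjoint.
\<close>

definition adjoint_group :: "('a::alg_closed_field^'n^'n) set \<Rightarrow> bool"
  where "adjoint_group G \<longleftrightarrow>
    semisimple_group G \<and>
    (\<forall>\<phi>. regular_function_on G \<phi> \<longrightarrow> (\<exists>\<psi>\<in>Ad_regular_functions G. \<forall>A\<in>G. \<phi> A = \<psi> A))"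


section \<open>Rational points and quasihomomorphisms\<close>

definition extend_scalars :: "'k::field^'n^'n \<Rightarrow> 'k alg_closure^'n^'n"
  where "extend_scalars A = (\<chi> i j. to_ac (A $ i $ j))"

definition rational_points :: "('k::field alg_closure^'n^'n) set \<Rightarrow> ('k^'n^'n) monoid"
  where "rational_points G = matrix_group {A. extend_scalars A \<in> G}"

text \<open>
  The topology of \<open>G(K)\<close> is the subspace topology inherited from the space of all matrices
  over \<open>K\<close>. It coincides with the one inherited from \<open>GL\<^sub>n(K)\<close>, since inversion is continuous.
\<close>

definition bounded_in :: "('a::topological_space, 'm) monoid_scheme \<Rightarrow> 'a set \<Rightarrow> bool"
  where "bounded_in H S \<longleftrightarrow> (\<exists>C. compactin (top_of_set (carrier H)) C \<and> S \<subseteq> C)"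

definition defect_set ::
    "('g, 'l) monoid_scheme \<Rightarrow> ('a, 'm) monoid_scheme \<Rightarrow> ('g \<Rightarrow> 'a) \<Rightarrow> 'a set"
  where "defect_set \<Gamma> H f =
    {inv\<^bsub>H\<^esub> (f y) \<otimes>\<^bsub>H\<^esub> inv\<^bsub>H\<^esub> (f x) \<otimes>\<^bsub>H\<^esub> f (x \<otimes>\<^bsub>\<Gamma>\<^esub> y) |x y. x \<in> carrier \<Gamma> \<and> y \<in> carrier \<Gamma>}"

definition quasihomomorphism ::
    "('g, 'l) monoid_scheme \<Rightarrow> ('a::topological_space, 'm) monoid_scheme \<Rightarrow> ('g \<Rightarrow> 'a) \<Rightarrow> bool"
  where "quasihomomorphism \<Gamma> H f \<longleftrightarrow>
    f \<in> carrier \<Gamma> \<rightarrow> carrier H \<and> bounded_in H (defect_set \<Gamma> H f)"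

definition zariski_dense_in :: "('k::field^'n^'n) set \<Rightarrow> ('k alg_closure^'n^'n) set \<Rightarrow> bool"
  where "zariski_dense_in S G \<longleftrightarrow> G \<subseteq> zariski_GL closure_of (extend_scalars ` S)"

end

theory Submission
  imports Defs
begin

text \<open>
  Let \<open>D\<close> be the defect set of \<open>f\<close> and \<open>\<Delta>\<close> the subgroup that it generates, and write
  \<open>f (x y) = f x f y d(x, y)\<close>. Expanding \<open>f (x y z)\<close> in two ways gives the cocycle identity
  \<open>(f z)\<inverse> d(x, y) f z = d(y, z) d(x, y z) d(x y, z)\<inverse>\<close> (\<open>conj_defect\<close>). It has two consequences. The
  values of \<open>f\<close> normalize \<open>\<Delta>\<close> (\<open>image_group_normalizes_defect_group\<close>), and for each \<open>\<delta>\<close> in \<open>\<Delta>\<close> the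
  conjugates of \<open>\<delta>\<close> by all values of \<open>f\<close> form a bounded set (\<open>bounded_conj\<close>, \<open>bounded_conj_inverse\<close>),
  because each conjugate of a defect is a product of three defects or inverse defects.

  The group generated by the values of \<open>f\<close> is Zariski dense, so all of \<open>G\<close> normalizes the Zariski
  closure \<open>N\<close> of \<open>\<Delta>\<close>. As the closure of a group of rational points, \<open>N\<close> is an algebraic group defined
  over \<open>K\<close> (\<open>algebraic_K_group_closure\<close>). Simplicity over \<open>K\<close> leaves two cases. If \<open>N\<close> is trivial,
  then so is \<open>D\<close>, and \<open>f\<close> is a homomorphism.

  If \<open>N = G\<close>, then \<open>f\<close> is bounded, contrary to assumption. Indeed a linear functional on matrices that
  vanishes on \<open>\<Delta>\<close> vanishes on \<open>G\<close>, hence on its tangent space at the identity; so the Lie algebra lies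
  in the linear span of \<open>\<Delta>\<close> (\<open>lie_algebra_subset_span\<close>). Bounded conjugates of the elements of \<open>\<Delta>\<close>
  thus bound the matrix coefficients of \<open>Ad (f z)\<close> and of its inverse. For an adjoint group these
  generate all regular functions, in particular the entries and the inverse of the determinant, and
  bounds on those mean that \<open>f\<close> has values in a compact subset of \<open>G(K)\<close>
  (\<open>bounded_in_if_conj_bounded\<close>). As the algebraic closure of \<open>K\<close> has no topology, boundedness there
  means boundedness inside a finite-dimensional \<open>K\<close>-subspace, and \<open>K\<close>-linear functionals carry it
  back to \<open>K\<close>.
\<close>


section \<open>Quasihomomorphisms into bornological groups\<close>

locale group_valued_map = \<Gamma>: group \<Gamma> + H: group H
  for \<Gamma> :: "('g, 'm) monoid_scheme" and H :: "('h, 'l) monoid_scheme" +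
  fixes f :: "'g \<Rightarrow> 'h"
  assumes f_closed: "f \<in> carrier \<Gamma> \<rightarrow> carrier H"
begin

definition defect :: "'g \<Rightarrow> 'g \<Rightarrow> 'h"
  where "defect x y = inv\<^bsub>H\<^esub> (f y) \<otimes>\<^bsub>H\<^esub> inv\<^bsub>H\<^esub> (f x) \<otimes>\<^bsub>H\<^esub> f (x \<otimes>\<^bsub>\<Gamma>\<^esub> y)"

lemma f_in [simp]: "x \<in> carrier \<Gamma> \<Longrightarrow> f x \<in> carrier H"
  using f_closed by blast

lemma defect_closed [simp]:
  "x \<in> carrier \<Gamma> \<Longrightarrow> y \<in> carrier \<Gamma> \<Longrightarrow> defect x y \<in> carrier H"
  by (simp add: defect_def)

lemma defect_set_eq: "defect_set \<Gamma> H f = {defect x y |x y. x \<in> carrier \<Gamma> \<and> y \<in> carrier \<Gamma>}"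
  by (simp add: defect_set_def defect_def)

lemma defect_in: "x \<in> carrier \<Gamma> \<Longrightarrow> y \<in> carrier \<Gamma> \<Longrightarrow> defect x y \<in> defect_set \<Gamma> H f"
  by (auto simp: defect_set_eq)

lemma defect_set_closed: "defect_set \<Gamma> H f \<subseteq> carrier H"
  by (auto simp: defect_set_eq)

lemma map_mult:
  assumes "x \<in> carrier \<Gamma>" "y \<in> carrier \<Gamma>"
  shows "f (x \<otimes>\<^bsub>\<Gamma>\<^esub> y) = f x \<otimes>\<^bsub>H\<^esub> f y \<otimes>\<^bsub>H\<^esub> defect x y"
proof -
  have "f x \<otimes>\<^bsub>H\<^esub> (f y \<otimes>\<^bsub>H\<^esub> (inv\<^bsub>H\<^esub> (f y) \<otimes>\<^bsub>H\<^esub> (inv\<^bsub>H\<^esub> (f x) \<otimes>\<^bsub>H\<^esub> f (x \<otimes>\<^bsub>\<Gamma>\<^esub> y)))) = f (x \<otimes>\<^bsub>\<Gamma>\<^esub> y)"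
    using assms by (simp flip: H.m_assoc)
  then show ?thesis
    using assms by (simp add: defect_def H.m_assoc)
qed

lemma hom_if_trivial_defect:
  assumes "defect_set \<Gamma> H f \<subseteq> {\<one>\<^bsub>H\<^esub>}"
  shows "f \<in> hom \<Gamma> H"
proof -
  have "defect x y = \<one>\<^bsub>H\<^esub>" if "x \<in> carrier \<Gamma>" "y \<in> carrier \<Gamma>" for x y
    using defect_in[OF that] assms by blast
  then show ?thesis
    by (auto simp: hom_def map_mult)
qed

text \<open>
  Expanding \<open>f (x y z)\<close> with either bracketing shows that conjugating a defect by a value of
  \<open>f\<close> gives a product of two defects and an inverse defect, however large that value is.
\<close>

lemma conj_defect:
  assumes "x \<in> carrier \<Gamma>" "y \<in> carrier \<Gamma>" "z \<in> carrier \<Gamma>"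
  shows "inv\<^bsub>H\<^esub> (f z) \<otimes>\<^bsub>H\<^esub> defect x y \<otimes>\<^bsub>H\<^esub> f z =
    defect y z \<otimes>\<^bsub>H\<^esub> defect x (y \<otimes>\<^bsub>\<Gamma>\<^esub> z) \<otimes>\<^bsub>H\<^esub> inv\<^bsub>H\<^esub> (defect (x \<otimes>\<^bsub>\<Gamma>\<^esub> y) z)"
proof -
  let ?l = "defect x y \<otimes>\<^bsub>H\<^esub> f z \<otimes>\<^bsub>H\<^esub> defect (x \<otimes>\<^bsub>\<Gamma>\<^esub> y) z"
  let ?r = "f z \<otimes>\<^bsub>H\<^esub> defect y z \<otimes>\<^bsub>H\<^esub> defect x (y \<otimes>\<^bsub>\<Gamma>\<^esub> z)"
  have "f (x \<otimes>\<^bsub>\<Gamma>\<^esub> y \<otimes>\<^bsub>\<Gamma>\<^esub> z) = f x \<otimes>\<^bsub>H\<^esub> f y \<otimes>\<^bsub>H\<^esub> ?l"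
    using assms by (simp add: map_mult H.m_assoc)
  moreover have "f (x \<otimes>\<^bsub>\<Gamma>\<^esub> (y \<otimes>\<^bsub>\<Gamma>\<^esub> z)) = f x \<otimes>\<^bsub>H\<^esub> f y \<otimes>\<^bsub>H\<^esub> ?r"
    using assms map_mult[of x "y \<otimes>\<^bsub>\<Gamma>\<^esub> z"] map_mult[of y z] by (simp add: H.m_assoc)
  ultimately have eq: "?l = ?r"
    using assms by (simp add: \<Gamma>.m_assoc H.m_assoc)
  have "defect x y \<otimes>\<^bsub>H\<^esub> f z = ?r \<otimes>\<^bsub>H\<^esub> inv\<^bsub>H\<^esub> (defect (x \<otimes>\<^bsub>\<Gamma>\<^esub> y) z)"
    unfolding eq[symmetric] using assms by (simp add: H.m_assoc)
  then have "inv\<^bsub>H\<^esub> (f z) \<otimes>\<^bsub>H\<^esub> (defect x y \<otimes>\<^bsub>H\<^esub> f z) =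
      inv\<^bsub>H\<^esub> (f z) \<otimes>\<^bsub>H\<^esub> (f z \<otimes>\<^bsub>H\<^esub> (defect y z \<otimes>\<^bsub>H\<^esub> defect x (y \<otimes>\<^bsub>\<Gamma>\<^esub> z) \<otimes>\<^bsub>H\<^esub>
        inv\<^bsub>H\<^esub> (defect (x \<otimes>\<^bsub>\<Gamma>\<^esub> y) z)))"
    using assms by (simp add: H.m_assoc)
  then show ?thesis
    using assms by (simp flip: H.m_assoc)
qed

lemma map_one: "f \<one>\<^bsub>\<Gamma>\<^esub> = inv\<^bsub>H\<^esub> (defect \<one>\<^bsub>\<Gamma>\<^esub> \<one>\<^bsub>\<Gamma>\<^esub>)"
proof -
  have "f \<one>\<^bsub>\<Gamma>\<^esub> \<otimes>\<^bsub>H\<^esub> (f \<one>\<^bsub>\<Gamma>\<^esub> \<otimes>\<^bsub>H\<^esub> defect \<one>\<^bsub>\<Gamma>\<^esub> \<one>\<^bsub>\<Gamma>\<^esub>) = f \<one>\<^bsub>\<Gamma>\<^esub> \<otimes>\<^bsub>H\<^esub> \<one>\<^bsub>H\<^esub>"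
    using map_mult[of "\<one>\<^bsub>\<Gamma>\<^esub>" "\<one>\<^bsub>\<Gamma>\<^esub>"] by (simp add: H.m_assoc)
  then have "f \<one>\<^bsub>\<Gamma>\<^esub> \<otimes>\<^bsub>H\<^esub> defect \<one>\<^bsub>\<Gamma>\<^esub> \<one>\<^bsub>\<Gamma>\<^esub> = \<one>\<^bsub>H\<^esub>"
    by (subst (asm) H.l_cancel) auto
  then show ?thesis
    by (simp add: H.inv_equality H.inv_unique')
qed

text \<open>
  Comparing \<open>f (z z\<inverse>)\<close> with \<open>f 1\<close> shows that inverses of values of \<open>f\<close> are again values up to a
  correction from the defect group: this is the error \<open>e\<close> in \<open>(f z)\<inverse> = f (z\<inverse>) e\<close>. It is a product of
  two defects, hence bounded uniformly in \<open>z\<close>.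
\<close>

definition inv_error :: "'g \<Rightarrow> 'h"
  where "inv_error z = defect z (inv\<^bsub>\<Gamma>\<^esub> z) \<otimes>\<^bsub>H\<^esub> defect \<one>\<^bsub>\<Gamma>\<^esub> \<one>\<^bsub>\<Gamma>\<^esub>"

lemma inv_error_closed [simp]: "z \<in> carrier \<Gamma> \<Longrightarrow> inv_error z \<in> carrier H"
  by (simp add: inv_error_def)

lemma inv_map:
  assumes z: "z \<in> carrier \<Gamma>"
  shows "inv\<^bsub>H\<^esub> (f z) = f (inv\<^bsub>\<Gamma>\<^esub> z) \<otimes>\<^bsub>H\<^esub> inv_error z"
proof -
  have "inv\<^bsub>H\<^esub> (defect \<one>\<^bsub>\<Gamma>\<^esub> \<one>\<^bsub>\<Gamma>\<^esub>) = f z \<otimes>\<^bsub>H\<^esub> f (inv\<^bsub>\<Gamma>\<^esub> z) \<otimes>\<^bsub>H\<^esub> defect z (inv\<^bsub>\<Gamma>\<^esub> z)"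
    using map_mult[of z "inv\<^bsub>\<Gamma>\<^esub> z"] z by (simp add: map_one)
  then have "f z \<otimes>\<^bsub>H\<^esub> f (inv\<^bsub>\<Gamma>\<^esub> z) \<otimes>\<^bsub>H\<^esub> defect z (inv\<^bsub>\<Gamma>\<^esub> z) \<otimes>\<^bsub>H\<^esub> defect \<one>\<^bsub>\<Gamma>\<^esub> \<one>\<^bsub>\<Gamma>\<^esub> = \<one>\<^bsub>H\<^esub>"
    by (metis H.l_inv \<Gamma>.one_closed defect_closed)
  then have "f z \<otimes>\<^bsub>H\<^esub> (f (inv\<^bsub>\<Gamma>\<^esub> z) \<otimes>\<^bsub>H\<^esub> inv_error z) = \<one>\<^bsub>H\<^esub>"
    using z by (simp add: inv_error_def H.m_assoc)
  then show ?thesis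
    using z by (metis H.inv_comm H.inv_equality H.m_closed \<Gamma>.inv_closed f_in inv_error_closed)
qed

abbreviation defect_group :: "'h set"
  where "defect_group \<equiv> generate H (defect_set \<Gamma> H f)"

lemma defect_group_subgroup: "subgroup defect_group H"
  by (rule H.generate_is_subgroup[OF defect_set_closed])

lemma defect_group_closed [simp]: "\<delta> \<in> defect_group \<Longrightarrow> \<delta> \<in> carrier H"
  using subgroup.mem_carrier[OF defect_group_subgroup] .

lemma inv_error_in: "z \<in> carrier \<Gamma> \<Longrightarrow> inv_error z \<in> defect_group"
  by (simp add: inv_error_def generate.eng generate.incl defect_in)

lemma conj_mult:
  assumes "g \<in> carrier H" "a \<in> carrier H" "b \<in> carrier H"
  shows "inv\<^bsub>H\<^esub> g \<otimes>\<^bsub>H\<^esub> (a \<otimes>\<^bsub>H\<^esub> b) \<otimes>\<^bsub>H\<^esub> g =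
    (inv\<^bsub>H\<^esub> g \<otimes>\<^bsub>H\<^esub> a \<otimes>\<^bsub>H\<^esub> g) \<otimes>\<^bsub>H\<^esub> (inv\<^bsub>H\<^esub> g \<otimes>\<^bsub>H\<^esub> b \<otimes>\<^bsub>H\<^esub> g)"
proof -
  have "g \<otimes>\<^bsub>H\<^esub> (inv\<^bsub>H\<^esub> g \<otimes>\<^bsub>H\<^esub> (b \<otimes>\<^bsub>H\<^esub> g)) = b \<otimes>\<^bsub>H\<^esub> g"
    using assms by (simp flip: H.m_assoc)
  then show ?thesis
    using assms by (simp add: H.m_assoc)
qed

lemma conj_inv:
  assumes "g \<in> carrier H" "a \<in> carrier H"
  shows "inv\<^bsub>H\<^esub> g \<otimes>\<^bsub>H\<^esub> inv\<^bsub>H\<^esub> a \<otimes>\<^bsub>H\<^esub> g = inv\<^bsub>H\<^esub> (inv\<^bsub>H\<^esub> g \<otimes>\<^bsub>H\<^esub> a \<otimes>\<^bsub>H\<^esub> g)"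
  using assms by (simp add: H.inv_mult_group H.m_assoc)

lemma conj_defect_group:
  assumes z: "z \<in> carrier \<Gamma>" and "\<delta> \<in> defect_group"
  shows "inv\<^bsub>H\<^esub> (f z) \<otimes>\<^bsub>H\<^esub> \<delta> \<otimes>\<^bsub>H\<^esub> f z \<in> defect_group"
proof -
  have incl: "inv\<^bsub>H\<^esub> (f z) \<otimes>\<^bsub>H\<^esub> h \<otimes>\<^bsub>H\<^esub> f z \<in> defect_group" if h: "h \<in> defect_set \<Gamma> H f" for h
  proof -
    obtain x y where xy: "x \<in> carrier \<Gamma>" "y \<in> carrier \<Gamma>" "h = defect x y"
      using h by (auto simp: defect_set_eq)
    show ?thesis
      unfolding xy(3) conj_defect[OF xy(1,2) z]
      using z xy by (intro generate.eng generate.incl generate.inv defect_in) auto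
  qed
  show ?thesis
    using assms(2)
  proof (induction rule: generate.induct)
    case one
    then show ?case using z by (simp add: generate.one)
  next
    case (inv h)
    then have "h \<in> carrier H" using defect_set_closed by blast
    then show ?case
      using z inv incl H.generate_m_inv_closed[OF defect_set_closed] by (simp add: conj_inv)
  next
    case (eng a b)
    then show ?case using z by (simp add: conj_mult generate.eng)
  qed (rule incl)
qed

text \<open>
  The cocycle computation controls \<open>(f z)\<inverse> \<delta> f z\<close> only. The opposite conjugation is reduced to it by
  replacing \<open>f z\<close> by the inverse of \<open>f (z\<inverse>)\<close>, up to the bounded error of that replacement.
\<close>

lemma conj_by_map_eq:
  assumes z: "z \<in> carrier \<Gamma>" and \<delta>: "\<delta> \<in> carrier H"
  shows "f z \<otimes>\<^bsub>H\<^esub> \<delta> \<otimes>\<^bsub>H\<^esub> inv\<^bsub>H\<^esub> (f z) =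
    inv\<^bsub>H\<^esub> (inv_error z) \<otimes>\<^bsub>H\<^esub>
      (inv\<^bsub>H\<^esub> (f (inv\<^bsub>\<Gamma>\<^esub> z)) \<otimes>\<^bsub>H\<^esub> \<delta> \<otimes>\<^bsub>H\<^esub> f (inv\<^bsub>\<Gamma>\<^esub> z)) \<otimes>\<^bsub>H\<^esub> inv_error z"
proof -
  have "f z = inv\<^bsub>H\<^esub> (inv_error z) \<otimes>\<^bsub>H\<^esub> inv\<^bsub>H\<^esub> (f (inv\<^bsub>\<Gamma>\<^esub> z))"
    using inv_map[OF z] z by (metis H.inv_inv H.inv_mult_group \<Gamma>.inv_closed f_in inv_error_closed)
  then have "f z \<otimes>\<^bsub>H\<^esub> \<delta> \<otimes>\<^bsub>H\<^esub> inv\<^bsub>H\<^esub> (f z) =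
    (inv\<^bsub>H\<^esub> (inv_error z) \<otimes>\<^bsub>H\<^esub> inv\<^bsub>H\<^esub> (f (inv\<^bsub>\<Gamma>\<^esub> z))) \<otimes>\<^bsub>H\<^esub> \<delta> \<otimes>\<^bsub>H\<^esub>
      (f (inv\<^bsub>\<Gamma>\<^esub> z) \<otimes>\<^bsub>H\<^esub> inv_error z)"
    using inv_map[OF z] by simp
  then show ?thesis
    using z \<delta> by (simp add: H.m_assoc)
qed

lemma conj_inverse_defect_group:
  assumes z: "z \<in> carrier \<Gamma>" and \<delta>: "\<delta> \<in> defect_group"
  shows "f z \<otimes>\<^bsub>H\<^esub> \<delta> \<otimes>\<^bsub>H\<^esub> inv\<^bsub>H\<^esub> (f z) \<in> defect_group"
  using z \<delta>
  by (auto simp: conj_by_map_eq intro!: generate.eng conj_defect_group inv_error_in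
      H.generate_m_inv_closed[OF defect_set_closed])

lemma image_group_normalizes_defect_group:
  assumes "g \<in> generate H (f ` carrier \<Gamma>)" and "\<delta> \<in> defect_group"
  shows "g \<otimes>\<^bsub>H\<^esub> \<delta> \<otimes>\<^bsub>H\<^esub> inv\<^bsub>H\<^esub> g \<in> defect_group"
  using assms
proof (induction arbitrary: \<delta> rule: generate.induct)
  case (eng a b)
  have carr: "a \<in> carrier H" "b \<in> carrier H" "\<delta> \<in> carrier H"
    using eng H.generate_in_carrier[OF funcset_image[OF f_closed]] by auto
  have "a \<otimes>\<^bsub>H\<^esub> (b \<otimes>\<^bsub>H\<^esub> \<delta> \<otimes>\<^bsub>H\<^esub> inv\<^bsub>H\<^esub> b) \<otimes>\<^bsub>H\<^esub> inv\<^bsub>H\<^esub> a \<in> defect_group"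
    using eng by blast
  then show ?case
    using carr by (simp add: H.m_assoc H.inv_mult_group)
qed (auto simp: conj_inverse_defect_group conj_defect_group)

end

text \<open>
  These closure properties of the relatively compact sets are all that the argument uses about the
  topology of the target group.
\<close>

locale bornological_group = group H for H :: "('h, 'l) monoid_scheme" (structure) +
  fixes bounded :: "'h set \<Rightarrow> bool"
  assumes bounded_subset: "bounded S \<Longrightarrow> T \<subseteq> S \<Longrightarrow> bounded T"
    and bounded_singleton: "h \<in> carrier H \<Longrightarrow> bounded {h}"
    and bounded_mult: "bounded S \<Longrightarrow> bounded T \<Longrightarrow> bounded (S <#> T)"
    and bounded_inv: "bounded S \<Longrightarrow> bounded (m_inv H ` S)"
begin

lemma bounded_mult_family:
  assumes "bounded (u ` I)" "bounded (v ` I)"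
  shows "bounded ((\<lambda>x. u x \<otimes> v x) ` I)"
  by (rule bounded_subset[OF bounded_mult[OF assms]]) (auto simp: set_mult_def)

lemma bounded_inv_family:
  assumes "bounded (u ` I)"
  shows "bounded ((\<lambda>x. inv (u x)) ` I)"
  using bounded_inv[OF assms] by (simp add: image_image)

end

locale bornological_quasihomomorphism =
  group_valued_map \<Gamma> H f + bornological_group H bounded
  for \<Gamma> :: "('g, 'm) monoid_scheme" and H :: "('h, 'l) monoid_scheme"
    and f :: "'g \<Rightarrow> 'h" and bounded :: "'h set \<Rightarrow> bool" +
  assumes bounded_defect_set: "bounded (defect_set \<Gamma> H f)"
begin

lemma bounded_defect_family:
  assumes "\<And>i. i \<in> I \<Longrightarrow> a i \<in> carrier \<Gamma>" "\<And>i. i \<in> I \<Longrightarrow> b i \<in> carrier \<Gamma>"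
  shows "bounded ((\<lambda>i. defect (a i) (b i)) ` I)"
  by (rule bounded_subset[OF bounded_defect_set]) (auto intro!: defect_in assms)

text \<open>
  Conjugates of one defect by all values of \<open>f\<close> are products of two defects and an inverse defect, so they stay in a
  bounded set. An element of the defect group is a finite product of defects and their inverses, and
  conjugation respects products.
\<close>

lemma bounded_conj:
  assumes "\<delta> \<in> defect_group"
  shows "bounded ((\<lambda>z. inv\<^bsub>H\<^esub> (f z) \<otimes>\<^bsub>H\<^esub> \<delta> \<otimes>\<^bsub>H\<^esub> f z) ` carrier \<Gamma>)"
proof -
  have incl: "bounded ((\<lambda>z. inv\<^bsub>H\<^esub> (f z) \<otimes>\<^bsub>H\<^esub> h \<otimes>\<^bsub>H\<^esub> f z) ` carrier \<Gamma>)"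
    if h: "h \<in> defect_set \<Gamma> H f" for h
  proof -
    obtain x y where xy: "x \<in> carrier \<Gamma>" "y \<in> carrier \<Gamma>" "h = defect x y"
      using h by (auto simp: defect_set_eq)
    have "bounded ((\<lambda>z. defect y z \<otimes>\<^bsub>H\<^esub> defect x (y \<otimes>\<^bsub>\<Gamma>\<^esub> z) \<otimes>\<^bsub>H\<^esub>
        inv\<^bsub>H\<^esub> (defect (x \<otimes>\<^bsub>\<Gamma>\<^esub> y) z)) ` carrier \<Gamma>)"
      using xy by (intro bounded_mult_family bounded_inv_family bounded_defect_family) auto
    then show ?thesis
      using xy by (simp add: conj_defect cong: image_cong_simp)
  qed
  show ?thesis
    using assms
  proof (induction rule: generate.induct)
    case one
    show ?case
      by (rule bounded_subset[OF bounded_singleton[OF H.one_closed]]) auto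
  next
    case (inv h)
    then have "h \<in> carrier H" using defect_set_closed by blast
    then show ?case
      using bounded_inv_family[OF incl[OF inv]] by (simp add: conj_inv cong: image_cong_simp)
  next
    case (eng a b)
    then show ?case
      using bounded_mult_family[OF eng.IH] by (simp add: conj_mult cong: image_cong_simp)
  qed (rule incl)
qed

lemma bounded_conj_inverse:
  assumes \<delta>: "\<delta> \<in> defect_group"
  shows "bounded ((\<lambda>z. f z \<otimes>\<^bsub>H\<^esub> \<delta> \<otimes>\<^bsub>H\<^esub> inv\<^bsub>H\<^esub> (f z)) ` carrier \<Gamma>)"
proof -
  have conj: "bounded ((\<lambda>z. inv\<^bsub>H\<^esub> (f (inv\<^bsub>\<Gamma>\<^esub> z)) \<otimes>\<^bsub>H\<^esub> \<delta> \<otimes>\<^bsub>H\<^esub> f (inv\<^bsub>\<Gamma>\<^esub> z)) ` carrier \<Gamma>)"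
    by (rule bounded_subset[OF bounded_conj[OF \<delta>]]) auto
  have err: "bounded (inv_error ` carrier \<Gamma>)"
    unfolding inv_error_def by (intro bounded_mult_family bounded_defect_family) auto
  have "bounded ((\<lambda>z. inv\<^bsub>H\<^esub> (inv_error z) \<otimes>\<^bsub>H\<^esub>
      (inv\<^bsub>H\<^esub> (f (inv\<^bsub>\<Gamma>\<^esub> z)) \<otimes>\<^bsub>H\<^esub> \<delta> \<otimes>\<^bsub>H\<^esub> f (inv\<^bsub>\<Gamma>\<^esub> z)) \<otimes>\<^bsub>H\<^esub> inv_error z) ` carrier \<Gamma>)"
    by (rule bounded_mult_family[OF bounded_mult_family[OF bounded_inv_family[OF err] conj] err])
  then show ?thesis
    using \<delta> by (simp add: conj_by_map_eq cong: image_cong_simp)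
qed

end


section \<open>Linear functionals\<close>

text \<open>
  Take a basis of \<open>span S\<close>, adjoin \<open>x\<close>, extend to a basis of the whole space: the coordinate at \<open>x\<close> is
  the required functional. This is used for \<open>K\<close>-linear functionals on the algebraic closure of \<open>K\<close>,
  and for linear functionals on matrices.
\<close>

lemma (in vector_space) separating_functional:
  assumes x: "x \<notin> span S"
  shows "\<exists>\<phi>. (\<forall>u v. \<phi> (u + v) = \<phi> u + \<phi> v) \<and> (\<forall>c v. \<phi> (scale c v) = c * \<phi> v) \<and>
    \<phi> x = 1 \<and> (\<forall>s\<in>S. \<phi> s = 0)"
proof -
  obtain B0 where B0: "B0 \<subseteq> S" "independent B0" "S \<subseteq> span B0"
    by (rule maximal_independent_subset)
  have x0: "x \<notin> span B0"
    using x span_mono[OF B0(1)] by blast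
  obtain B where B: "insert x B0 \<subseteq> B" "independent B" "UNIV \<subseteq> span B"
    by (rule maximal_independent_subset_extend[OF subset_UNIV independent_insertI[OF x0 B0(2)]])
  have "representation B s x = 0" if "s \<in> S" for s
  proof -
    have "representation B s = representation B0 s"
      using B B0 that by (intro representation_extend) auto
    then show ?thesis
      using representation_ne_zero[of B0 s x] x0 span_base by force
  qed
  moreover have "v \<in> span B" for v
    using B(3) by blast
  ultimately show ?thesis
    using B by (intro exI[of _ "\<lambda>v. representation B v x"])
      (auto simp: representation_add representation_scale representation_basis)
qed

interpretation ac: vector_space "\<lambda>(c::'k::field) (x::'k alg_closure). to_ac c * x"
  by unfold_locales (simp_all add: algebra_simps)

text \<open>
  The algebraic closure of \<open>K\<close> carries no topology. Its \<open>K\<close>-linear functionals bring statements about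
  polynomials with coefficients in the algebraic closure back to \<open>K\<close>.
\<close>

definition K_functional :: "('k::field alg_closure \<Rightarrow> 'k) \<Rightarrow> bool"
  where "K_functional \<pi> \<longleftrightarrow> (\<forall>x y. \<pi> (x + y) = \<pi> x + \<pi> y) \<and> (\<forall>c x. \<pi> (to_ac c * x) = c * \<pi> x)"

lemma K_functional_add: "K_functional \<pi> \<Longrightarrow> \<pi> (x + y) = \<pi> x + \<pi> y"
  and K_functional_scale: "K_functional \<pi> \<Longrightarrow> \<pi> (to_ac c * x) = c * \<pi> x"
  by (auto simp: K_functional_def)

lemma K_functional_zero: "K_functional \<pi> \<Longrightarrow> \<pi> 0 = 0"
  using K_functional_scale[of \<pi> 0 0] by simp

lemma K_functional_sum: "K_functional \<pi> \<Longrightarrow> \<pi> (sum g I) = (\<Sum>i\<in>I. \<pi> (g i))"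
  by (induction I rule: infinite_finite_induct) (auto simp: K_functional_add K_functional_zero)

lemma K_functional_to_ac: "K_functional \<pi> \<Longrightarrow> \<pi> 1 = 1 \<Longrightarrow> \<pi> (to_ac c) = c"
  using K_functional_scale[of \<pi> c 1] by simp

lemma ex_K_functional:
  assumes "x \<noteq> 0"
  shows "\<exists>\<pi>. K_functional \<pi> \<and> \<pi> x = 1"
  using ac.separating_functional[of x "{}"] assms by (auto simp: K_functional_def)


section \<open>Polynomial functions of a matrix\<close>

text \<open>
  The functions given by matrix polynomials, described without coefficients, so that properties such
  as continuity follow by induction.
\<close>

inductive_set poly_fun :: "('a::comm_ring_1^'n^'n \<Rightarrow> 'a) set" where
  const: "(\<lambda>A. c) \<in> poly_fun"
| entry: "(\<lambda>A. A $ i $ j) \<in> poly_fun"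
| add: "\<phi> \<in> poly_fun \<Longrightarrow> \<psi> \<in> poly_fun \<Longrightarrow> (\<lambda>A. \<phi> A + \<psi> A) \<in> poly_fun"
| mult: "\<phi> \<in> poly_fun \<Longrightarrow> \<psi> \<in> poly_fun \<Longrightarrow> (\<lambda>A. \<phi> A * \<psi> A) \<in> poly_fun"

lemma poly_fun_sum:
  "(\<And>i. i \<in> I \<Longrightarrow> \<phi> i \<in> poly_fun) \<Longrightarrow> (\<lambda>A. \<Sum>i\<in>I. \<phi> i A) \<in> poly_fun"
  by (induction I rule: infinite_finite_induct) (simp_all add: poly_fun.const poly_fun.add poly_fun.mult)

lemma poly_fun_prod:
  "(\<And>i. i \<in> I \<Longrightarrow> \<phi> i \<in> poly_fun) \<Longrightarrow> (\<lambda>A. \<Prod>i\<in>I. \<phi> i A) \<in> poly_fun"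
  by (induction I rule: infinite_finite_induct) (simp_all add: poly_fun.const poly_fun.add poly_fun.mult)

lemma poly_fun_power: "\<phi> \<in> poly_fun \<Longrightarrow> (\<lambda>A. \<phi> A ^ m) \<in> poly_fun"
  by (induction m) (simp_all add: poly_fun.const poly_fun.add poly_fun.mult)

lemma poly_fun_det:
  fixes F :: "'a::comm_ring_1^'n^'n \<Rightarrow> 'a^'m^'m"
  assumes "\<And>i j. (\<lambda>A. F A $ i $ j) \<in> poly_fun"
  shows "(\<lambda>A. det (F A)) \<in> poly_fun"
  unfolding det_def by (intro poly_fun_sum poly_fun.mult poly_fun_prod poly_fun.const assms)

text \<open>
  The numerator in Cramer's formula for the \<open>(i, j)\<close> entry of the inverse, that is, an entry of the
  adjugate matrix.
\<close>

definition cofactor_entry :: "'n \<Rightarrow> 'n \<Rightarrow> 'a::comm_ring_1^'n^'n \<Rightarrow> 'a"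
  where "cofactor_entry i j A = det (\<chi> k l. if l = i then (mat 1 :: 'a^'n^'n) $ k $ j else A $ k $ l)"

lemma poly_fun_cofactor_entry: "(cofactor_entry i j :: 'a::comm_ring_1^'n^'n \<Rightarrow> 'a) \<in> poly_fun"
proof -
  have "(\<lambda>A :: 'a^'n^'n. (\<chi> k l. if l = i then (mat 1 :: 'a^'n^'n) $ k $ j else A $ k $ l) $ r $ s) \<in> poly_fun" for r s
    by (cases "s = i") (simp_all add: poly_fun.const poly_fun.entry)
  from poly_fun_det[OF this] show ?thesis
    unfolding cofactor_entry_def[abs_def] .
qed

lemma matrix_inv_right:
  fixes A :: "'a::semiring_1^'n^'n"
  shows "invertible A \<Longrightarrow> A ** matrix_inv A = mat 1"
  and matrix_inv_left: "invertible A \<Longrightarrow> matrix_inv A ** A = mat 1"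
  unfolding invertible_def matrix_inv_def
  using someI_ex[of "\<lambda>B. A ** B = mat 1 \<and> B ** A = mat 1"] by blast+

lemma matrix_inv_unique:
  fixes A B :: "'a::semiring_1^'n^'n"
  assumes "A ** B = mat 1" "B ** A = mat 1"
  shows "matrix_inv A = B"
proof -
  have "invertible A" using assms by (auto simp: invertible_def)
  then have "matrix_inv A = matrix_inv A ** (A ** B)"
    by (simp add: assms)
  also have "\<dots> = B"
    using matrix_inv_left[OF \<open>invertible A\<close>] by (simp add: matrix_mul_assoc)
  finally show ?thesis .
qed

lemma invertible_matrix_inv:
  fixes A :: "'a::semiring_1^'n^'n"
  shows "invertible A \<Longrightarrow> invertible (matrix_inv A)"
  using matrix_inv_left matrix_inv_right by (metis invertible_def)

lemma matrix_inv_entry: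
  fixes A :: "'a::field^'n^'n"
  assumes "invertible A"
  shows "matrix_inv A $ i $ j = cofactor_entry i j A / det A"
proof -
  let ?x = "\<chi> r. matrix_inv A $ r $ j" and ?b = "\<chi> r. (mat 1 :: 'a^'n^'n) $ r $ j"
  have "A *v ?x = ?b"
    using matrix_inv_right[OF assms]
    by (simp add: vec_eq_iff matrix_vector_mult_def matrix_matrix_mult_def)
  then have "?x = (\<chi> k. det (\<chi> i l. if l = k then ?b $ i else A $ i $ l) / det A)"
    using assms by (simp add: cramer invertible_det_nz)
  then have "?x $ i = det (\<chi> r l. if l = i then ?b $ r else A $ r $ l) / det A"
    by (metis (no_types, lifting) vec_lambda_beta)
  then show ?thesis
    by (simp add: cofactor_entry_def cong: if_cong)
qed


section \<open>Evaluation of matrix polynomials\<close>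

definition monomial_at :: "'b::comm_semiring_1^'n^'n \<Rightarrow> ('n \<times> 'n \<Rightarrow>\<^sub>0 nat) \<Rightarrow> 'b"
  where "monomial_at A m = (\<Prod>(i, j)\<in>UNIV. (A $ i $ j) ^ Poly_Mapping.lookup m (i, j))"

lemma eval_at_monomial_at:
  "eval_at h A p = (\<Sum>m\<in>Poly_Mapping.keys p. h (Poly_Mapping.lookup p m) * monomial_at A m)"
  unfolding eval_at_def monomial_at_def
  by (intro sum.cong refl arg_cong2[of _ _ _ _ "(*)"] prod.mono_neutral_left)
    (auto simp: in_keys_iff)

lemma monomial_at_zero [simp]: "monomial_at A 0 = 1"
  by (simp add: monomial_at_def case_prod_beta)

lemma monomial_at_add: "monomial_at A (m + m') = monomial_at A m * monomial_at A m'"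
  by (simp add: monomial_at_def lookup_add power_add prod.distrib case_prod_beta)

lemma monomial_at_single: "monomial_at A (Poly_Mapping.single (i, j) 1) = A $ i $ j"
proof -
  have "(case x of (k, l) \<Rightarrow> (A $ k $ l) ^ Poly_Mapping.lookup (Poly_Mapping.single (i, j) (1::nat)) (k, l)) =
      (if x = (i, j) then A $ i $ j else 1)" for x
    by (auto simp: lookup_single split: prod.split)
  then show ?thesis
    unfolding monomial_at_def by simp
qed

lemma monomial_at_extend_scalars: "monomial_at (extend_scalars A) m = to_ac (monomial_at A m)"
  by (simp add: monomial_at_def extend_scalars_def to_ac_prod case_prod_beta)

lemma eval_at_superset:
  assumes "finite S" "Poly_Mapping.keys p \<subseteq> S" "h 0 = 0"
  shows "eval_at h A p = (\<Sum>m\<in>S. h (Poly_Mapping.lookup p m) * monomial_at A m)"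
  unfolding eval_at_monomial_at using assms
  by (intro sum.mono_neutral_left) (auto simp: in_keys_iff)

lemma eval_at_single: "h 0 = 0 \<Longrightarrow> eval_at h A (Poly_Mapping.single m c) = h c * monomial_at A m"
  by (simp add: eval_at_monomial_at)

lemma eval_at_add:
  assumes "h 0 = 0" "\<And>a b. h (a + b) = h a + h b"
  shows "eval_at h A (p + q) = eval_at h A p + eval_at h A q"
  unfolding eval_at_monomial_at
  by (rule setsum_keys_plus_distrib[where f = "\<lambda>m c. h c * monomial_at A m"])
    (auto simp: assms distrib_right)

lemma eval_at_id_add: "eval_at id A (p + q) = eval_at id A p + eval_at id A q"
  by (rule eval_at_add) simp_all

lemma eval_at_sum:
  assumes "h 0 = 0" "\<And>a b. h (a + b) = h a + h b"
  shows "eval_at h A (sum p I) = (\<Sum>i\<in>I. eval_at h A (p i))"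
proof -
  have "eval_at h A 0 = 0" by (simp add: eval_at_def)
  then show ?thesis
    by (induction I rule: infinite_finite_induct) (auto simp: eval_at_add assms)
qed

lemma sum_of_monomials:
  "p = (\<Sum>m\<in>Poly_Mapping.keys p. Poly_Mapping.single m (Poly_Mapping.lookup p m))"
  by (rule poly_mapping_eqI) (auto simp: lookup_sum lookup_single when_def in_keys_iff)

lemma eval_at_mult:
  fixes p q :: "('a::comm_semiring_1, 'n::finite) matrix_poly"
  shows "eval_at id A (p * q) = eval_at id A p * eval_at id A q"
proof -
  let ?s = "\<lambda>p m. Poly_Mapping.single m (Poly_Mapping.lookup p m)"
  have "p * q = (\<Sum>m\<in>Poly_Mapping.keys p. \<Sum>l\<in>Poly_Mapping.keys q. ?s p m * ?s q l)"
    by (subst sum_of_monomials[of p], subst sum_of_monomials[of q]) (rule sum_product)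
  then have "eval_at id A (p * q) =
      (\<Sum>m\<in>Poly_Mapping.keys p. \<Sum>l\<in>Poly_Mapping.keys q. eval_at id A (?s p m * ?s q l))"
    by (simp add: eval_at_sum)
  also have "\<dots> = eval_at id A p * eval_at id A q"
    unfolding eval_at_monomial_at[of id A p] eval_at_monomial_at[of id A q] sum_product
    by (simp add: mult_single eval_at_single monomial_at_add mult.assoc mult.left_commute)
  finally show ?thesis .
qed

lemma poly_fun_eval_at: "(\<lambda>A. eval_at id A p) \<in> poly_fun"
proof -
  have "(\<lambda>A. monomial_at A m) \<in> poly_fun" for m :: "'b \<times> 'b \<Rightarrow>\<^sub>0 nat"
    unfolding monomial_at_def case_prod_beta
    by (intro poly_fun_prod poly_fun_power poly_fun.entry)
  then show ?thesis
    unfolding eval_at_monomial_at by (intro poly_fun_sum poly_fun.mult poly_fun.const)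
qed

lemma ex_poly_of_poly_fun:
  "\<phi> \<in> poly_fun \<Longrightarrow> \<exists>p. \<forall>A. \<phi> A = eval_at id A p"
proof (induction rule: poly_fun.induct)
  case (const c)
  show ?case by (rule exI[of _ "Poly_Mapping.single 0 c"]) (simp add: eval_at_single)
next
  case (entry i j)
  show ?case
    by (rule exI[of _ "Poly_Mapping.single (Poly_Mapping.single (i, j) 1) 1"])
      (simp only: eval_at_single monomial_at_single id_apply mult_1_left simp_thms)
next
  case (add \<phi> \<psi>)
  then obtain p q where "\<forall>A. \<phi> A = eval_at id A p" "\<forall>A. \<psi> A = eval_at id A q" by blast
  then show ?case by (intro exI[of _ "p + q"]) (metis eval_at_id_add)
next
  case (mult \<phi> \<psi>)
  then obtain p q where "\<forall>A. \<phi> A = eval_at id A p" "\<forall>A. \<psi> A = eval_at id A q" by blast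
  then show ?case by (intro exI[of _ "p * q"]) (metis eval_at_mult)
qed

lemma lookup_map: "g 0 = 0 \<Longrightarrow> Poly_Mapping.lookup (Poly_Mapping.map g p) m = g (Poly_Mapping.lookup p m)"
  by (simp add: Poly_Mapping.map.rep_eq when_def)

lemma keys_map: "Poly_Mapping.keys (Poly_Mapping.map g p) \<subseteq> Poly_Mapping.keys p"
  by (auto simp: in_keys_iff Poly_Mapping.map.rep_eq)

lemma eval_at_map_to_ac:
  "eval_at id (extend_scalars A) (Poly_Mapping.map to_ac p) = to_ac (eval_at id A p)"
  unfolding eval_at_superset[of "Poly_Mapping.keys p" "Poly_Mapping.map to_ac p" id, OF finite_keys keys_map id_apply]
  by (simp add: lookup_map monomial_at_extend_scalars eval_at_monomial_at to_ac_sum)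

lemma K_functional_eval_at:
  assumes "K_functional \<pi>"
  shows "\<pi> (eval_at id (extend_scalars A) p) = eval_at id A (Poly_Mapping.map \<pi> p)"
proof -
  have "\<pi> (c * to_ac x) = \<pi> c * x" for c x
    using K_functional_scale[OF assms, of x c] by (simp add: mult.commute)
  then show ?thesis
    unfolding eval_at_superset[of "Poly_Mapping.keys p" "Poly_Mapping.map \<pi> p" id, OF finite_keys keys_map id_apply]
    by (simp add: lookup_map[of \<pi>] K_functional_zero[OF assms] monomial_at_extend_scalars eval_at_monomial_at
        K_functional_sum[OF assms])
qed


section \<open>Vanishing ideals of sets of rational points\<close>

lemma module_mult: "Modules.module ((*) :: 'a::comm_ring_1 \<Rightarrow> 'a \<Rightarrow> 'a)"
  by unfold_locales (simp_all add: algebra_simps)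

lemma vanishing_ideal_ideal: "module.subspace (*) (vanishing_ideal S)"
  for S :: "('a::comm_ring_1^'n^'n) set"
  unfolding module.subspace_def[OF module_mult] vanishing_ideal_def
  by (simp add: eval_at_add eval_at_mult) (simp add: eval_at_def)

text \<open>
  Expand the coefficients of a polynomial \<open>p\<close> in a \<open>K\<close>-basis of the algebraic closure, so that \<open>p\<close>
  is a combination of polynomials over \<open>K\<close>. At a rational point the values of these are the
  coordinates of the value of \<open>p\<close>, so all of them vanish wherever \<open>p\<close> does. This holds over an
  imperfect field too.
\<close>

lemma vanishing_ideal_rational_points:
  fixes S :: "('k::field^'n^'n) set"
  defines "I \<equiv> vanishing_ideal (extend_scalars ` S)"
  shows "I = module.span (*) (I \<inter> range (Poly_Mapping.map (to_ac :: 'k \<Rightarrow> _)))"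
proof (rule antisym)
  show "module.span (*) (I \<inter> range (Poly_Mapping.map to_ac)) \<subseteq> I"
    unfolding I_def by (intro module.span_minimal[OF module_mult] vanishing_ideal_ideal) auto
next
  obtain B :: "'k alg_closure set" where B: "ac.independent B" "UNIV \<subseteq> ac.span B"
    using ac.maximal_independent_subset[of UNIV] by metis
  let ?r = "ac.representation B"
  have fun_r: "K_functional (\<lambda>x. ?r x b)" for b
    using B(1) subsetD[OF B(2) UNIV_I] unfolding K_functional_def
    by (simp add: ac.representation_add ac.representation_scale)
  show "I \<subseteq> module.span (*) (I \<inter> range (Poly_Mapping.map (to_ac :: 'k \<Rightarrow> _)))"
  proof
    fix p assume p: "p \<in> I"
    \<comment> \<open>the finitely many basis vectors that occur in some coefficient of \<open>p\<close>\<close>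
    define T where "T = (\<Union>m\<in>Poly_Mapping.keys p. {b. ?r (Poly_Mapping.lookup p m) b \<noteq> 0})"
    define q where "q b = Poly_Mapping.map to_ac (Poly_Mapping.map (\<lambda>x. ?r x b) p)" for b
    have "finite T"
      unfolding T_def by (auto simp: ac.finite_representation)
    have coeff: "(\<Sum>b\<in>T. b * to_ac (?r (Poly_Mapping.lookup p m) b)) = Poly_Mapping.lookup p m" for m
    proof (cases "m \<in> Poly_Mapping.keys p")
      case True
      have "(\<Sum>b | ?r (Poly_Mapping.lookup p m) b \<noteq> 0. to_ac (?r (Poly_Mapping.lookup p m) b) * b) =
          Poly_Mapping.lookup p m"
        using B by (intro ac.sum_nonzero_representation_eq) auto
      also have "(\<Sum>b | ?r (Poly_Mapping.lookup p m) b \<noteq> 0. to_ac (?r (Poly_Mapping.lookup p m) b) * b) =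
          (\<Sum>b\<in>T. to_ac (?r (Poly_Mapping.lookup p m) b) * b)"
        using True \<open>finite T\<close> by (intro sum.mono_neutral_left) (auto simp: T_def)
      finally show ?thesis by (simp add: mult.commute)
    qed (simp add: in_keys_iff ac.representation_zero)
    have q_I: "q b \<in> I" for b
    proof -
      have "eval_at id A (Poly_Mapping.map (\<lambda>x. ?r x b) p) = 0" if "A \<in> S" for A
        using p that by (simp flip: K_functional_eval_at[OF fun_r]
            add: I_def vanishing_ideal_def K_functional_zero[OF fun_r])
      then show ?thesis
        by (auto simp: I_def vanishing_ideal_def q_def eval_at_map_to_ac)
    qed
    have "p = (\<Sum>b\<in>T. Poly_Mapping.single 0 b * q b)"
      by (rule poly_mapping_eqI)
        (simp add: lookup_sum q_def lookup_map K_functional_zero[OF fun_r] coeff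
          flip: mult_map_scale_conv_mult)
    also have "\<dots> \<in> module.span (*) (I \<inter> range (Poly_Mapping.map (to_ac :: 'k \<Rightarrow> _)))"
      using q_I by (intro module.span_sum[OF module_mult] module.span_scale[OF module_mult]
          module.span_base[OF module_mult]) (auto simp: q_def)
    finally show "p \<in> module.span (*) (I \<inter> range (Poly_Mapping.map (to_ac :: 'k \<Rightarrow> _)))" .
  qed
qed


section \<open>Closures in groups with a Zariski-like topology\<close>

text \<open>
  With the Zariski topology \<open>GL\<^sub>n\<close> over an infinite field is not a topological group: multiplication
  is continuous in each factor, but not jointly for the product topology. Separate continuity and
  continuity of \<open>x \<mapsto> x a x\<inverse>\<close> are what closures of subgroups and of their normalizers need.
\<close>

locale conj_continuous_group = group G for G :: "('a, 'b) monoid_scheme" (structure) +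
  fixes T :: "'a topology"
  assumes topspace_eq: "topspace T = carrier G"
    and continuous_left: "a \<in> carrier G \<Longrightarrow> continuous_map T T (\<lambda>x. a \<otimes> x)"
    and continuous_right: "a \<in> carrier G \<Longrightarrow> continuous_map T T (\<lambda>x. x \<otimes> a)"
    and continuous_inv: "continuous_map T T (m_inv G)"
    and continuous_conj: "a \<in> carrier G \<Longrightarrow> continuous_map T T (\<lambda>x. x \<otimes> a \<otimes> inv x)"
begin

lemma closure_image_closed:
  assumes "continuous_map T T F" "F ` A \<subseteq> T closure_of B" "x \<in> T closure_of A"
  shows "F x \<in> T closure_of B"
proof -
  have "F x \<in> T closure_of (F ` A)"
    using continuous_map_image_closure_subset[OF assms(1)] assms(3) by blast
  also have "\<dots> \<subseteq> T closure_of B"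
    by (intro closure_of_minimal assms closedin_closure_of)
  finally show ?thesis .
qed

lemma subset_closure: "D \<subseteq> carrier G \<Longrightarrow> D \<subseteq> T closure_of D"
  by (simp add: closure_of_subset topspace_eq)

lemma closure_carrier: "T closure_of D \<subseteq> carrier G"
  using closure_of_subset_topspace[of T D] by (simp add: topspace_eq)

text \<open>
  Joint continuity is avoided by moving one factor at a time: first an element of \<open>D\<close> moves the
  closure of \<open>D\<close> into itself, then an element of the closure does.
\<close>

lemma subgroup_closure:
  assumes D: "subgroup D G"
  shows "subgroup (T closure_of D) G"
proof -
  note DG = subgroup.subset[OF D] and cl = subset_closure[OF subgroup.subset[OF D]]
  have left: "d \<otimes> y \<in> T closure_of D" if "d \<in> D" "y \<in> T closure_of D" for d y
    by (rule closure_image_closed[OF continuous_left _ that(2)])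
      (use that DG cl subgroup.m_closed[OF D] in auto)
  have "x \<otimes> y \<in> T closure_of D" if "x \<in> T closure_of D" "y \<in> T closure_of D" for x y
    by (rule closure_image_closed[OF continuous_right _ that(1)])
      (use that left closure_carrier in auto)
  moreover have "inv x \<in> T closure_of D" if "x \<in> T closure_of D" for x
    by (rule closure_image_closed[OF continuous_inv _ that])
      (use cl subgroup.m_inv_closed[OF D] in auto)
  ultimately show ?thesis
    using closure_carrier cl subgroup.one_closed[OF D] by (intro subgroup.intro) auto
qed

lemma closure_normalizes_closure:
  assumes "L \<subseteq> carrier G" "D \<subseteq> carrier G"
    and norm: "\<And>l d. l \<in> L \<Longrightarrow> d \<in> D \<Longrightarrow> l \<otimes> d \<otimes> inv l \<in> D"
    and "g \<in> T closure_of L" "h \<in> T closure_of D"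
  shows "g \<otimes> h \<otimes> inv g \<in> T closure_of D"
proof -
  have L: "l \<otimes> h \<otimes> inv l \<in> T closure_of D" if l: "l \<in> L" for l
  proof (rule closure_image_closed[OF _ _ \<open>h \<in> T closure_of D\<close>])
    show "continuous_map T T (\<lambda>x. l \<otimes> x \<otimes> inv l)"
      using continuous_map_compose[OF continuous_left[of l] continuous_right[of "inv l"]] l assms(1)
      by (auto simp: o_def)
    show "(\<lambda>x. l \<otimes> x \<otimes> inv l) ` D \<subseteq> T closure_of D"
      using norm[OF l] subset_closure[OF assms(2)] by auto
  qed
  show ?thesis
    by (rule closure_image_closed[OF continuous_conj _ \<open>g \<in> T closure_of L\<close>])
      (use L closure_carrier assms(5) in auto)
qed

end


section \<open>The Zariski topology on the general linear group\<close>

definition regular_on_GL :: "('a::field^'n^'n \<Rightarrow> 'a) \<Rightarrow> bool"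
  where "regular_on_GL \<phi> \<longleftrightarrow>
    (\<exists>P\<in>poly_fun. \<exists>m. \<forall>A. invertible A \<longrightarrow> \<phi> A = P A / det A ^ m)"

lemma regular_on_GLI:
  "P \<in> poly_fun \<Longrightarrow> (\<And>A. invertible A \<Longrightarrow> \<phi> A = P A / det A ^ m) \<Longrightarrow> regular_on_GL \<phi>"
  unfolding regular_on_GL_def by (intro bexI[of _ P] exI[of _ m]) auto

lemma regular_on_GL_poly_fun: "\<phi> \<in> poly_fun \<Longrightarrow> regular_on_GL \<phi>"
  unfolding regular_on_GL_def by (intro bexI[of _ \<phi>] exI[of _ 0]) auto

lemma poly_fun_det_power: "(\<lambda>A::'a::comm_ring_1^'n^'n. det A ^ m) \<in> poly_fun"
  by (intro poly_fun_power poly_fun_det poly_fun.entry)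

lemma regular_on_GL_add:
  assumes "regular_on_GL \<phi>" "regular_on_GL \<psi>"
  shows "regular_on_GL (\<lambda>A. \<phi> A + \<psi> A)"
proof -
  obtain P m Q l where P: "P \<in> poly_fun" "\<And>A. invertible A \<Longrightarrow> \<phi> A = P A / det A ^ m"
    and Q: "Q \<in> poly_fun" "\<And>A. invertible A \<Longrightarrow> \<psi> A = Q A / det A ^ l"
    using assms unfolding regular_on_GL_def by blast
  have "(\<lambda>A. P A * det A ^ l + Q A * det A ^ m) \<in> poly_fun"
    by (intro poly_fun.add poly_fun.mult P Q poly_fun_det_power)
  moreover have "\<phi> A + \<psi> A = (P A * det A ^ l + Q A * det A ^ m) / det A ^ (m + l)"
    if "invertible A" for A
    using that by (simp add: P(2) Q(2) invertible_det_nz power_add field_simps)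
  ultimately show ?thesis
    by (rule regular_on_GLI)
qed

lemma regular_on_GL_mult:
  assumes "regular_on_GL \<phi>" "regular_on_GL \<psi>"
  shows "regular_on_GL (\<lambda>A. \<phi> A * \<psi> A)"
proof -
  obtain P m Q l where P: "P \<in> poly_fun" "\<And>A. invertible A \<Longrightarrow> \<phi> A = P A / det A ^ m"
    and Q: "Q \<in> poly_fun" "\<And>A. invertible A \<Longrightarrow> \<psi> A = Q A / det A ^ l"
    using assms unfolding regular_on_GL_def by blast
  have "(\<lambda>A. P A * Q A) \<in> poly_fun"
    by (intro poly_fun.mult P Q)
  moreover have "\<phi> A * \<psi> A = (P A * Q A) / det A ^ (m + l)"
    if "invertible A" for A
    using that by (simp add: P(2) Q(2) power_add)
  ultimately show ?thesis
    by (rule regular_on_GLI)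
qed

lemma regular_on_GL_sum:
  "(\<And>i. i \<in> I \<Longrightarrow> regular_on_GL (\<phi> i)) \<Longrightarrow> regular_on_GL (\<lambda>A. \<Sum>i\<in>I. \<phi> i A)"
  by (induction I rule: infinite_finite_induct)
    (simp_all add: regular_on_GL_add regular_on_GL_poly_fun poly_fun.const)

lemma regular_on_GL_matrix_mult:
  fixes F H :: "'a::field^'n^'n \<Rightarrow> 'a^'n^'n"
  assumes "\<And>i j. regular_on_GL (\<lambda>A. F A $ i $ j)" "\<And>i j. regular_on_GL (\<lambda>A. H A $ i $ j)"
  shows "regular_on_GL (\<lambda>A. (F A ** H A) $ i $ j)"
  using assms by (simp add: matrix_matrix_mult_def regular_on_GL_sum regular_on_GL_mult)

lemma regular_on_GL_matrix_inv:
  fixes i j :: "'n::finite"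
  shows "regular_on_GL (\<lambda>A::'a::field^'n^'n. matrix_inv A $ i $ j)"
  unfolding regular_on_GL_def
  by (rule bexI[OF _ poly_fun_cofactor_entry[of i j]], rule exI[of _ 1]) (simp add: matrix_inv_entry)

text \<open>
  This makes every map with regular entries continuous for the Zariski topology: preimages of
  principal open sets are non-vanishing loci of regular functions, which are principal open sets again
  because the determinant is invertible.
\<close>

lemma regular_on_GL_compose:
  fixes F :: "'a::field^'n^'n \<Rightarrow> 'a^'n^'n"
  assumes "P \<in> poly_fun" "\<And>i j. regular_on_GL (\<lambda>A. F A $ i $ j)"
  shows "regular_on_GL (\<lambda>A. P (F A))"
  using assms(1)
  by induction (simp_all add: assms(2) regular_on_GL_add regular_on_GL_mult regular_on_GL_poly_fun poly_fun.const)

lemma topspace_zariski_GL: "topspace (zariski_GL :: ('a::field^'n^'n) topology) = {A. invertible A}"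
proof -
  have "eval_at id A (Poly_Mapping.single 0 1) \<noteq> 0" for A :: "'a^'n^'n"
    by (subst eval_at_single) simp_all
  then show ?thesis
    unfolding zariski_GL_def topology_generated_by_topspace by blast
qed

lemma openin_zariski_GL_regular:
  assumes "regular_on_GL \<phi>"
  shows "openin zariski_GL {A. invertible A \<and> \<phi> A \<noteq> 0}"
proof -
  obtain P m where P: "P \<in> poly_fun" "\<And>A. invertible A \<Longrightarrow> \<phi> A = P A / det A ^ m"
    using assms unfolding regular_on_GL_def by blast
  obtain p where "\<And>A. P A = eval_at id A p"
    using ex_poly_of_poly_fun[OF P(1)] by blast
  then have "{A. invertible A \<and> \<phi> A \<noteq> 0} = {A. invertible A \<and> eval_at id A p \<noteq> 0}"
    using P(2) by (auto simp: invertible_det_nz)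
  then show ?thesis
    unfolding zariski_GL_def by (auto intro: topology_generated_by_Basis)
qed

lemma continuous_map_zariski_GLI:
  fixes F :: "'b \<Rightarrow> 'a::field^'n^'n"
  assumes inv: "\<And>x. x \<in> topspace T \<Longrightarrow> invertible (F x)"
    and opn: "\<And>p. openin T {x \<in> topspace T. eval_at id (F x) p \<noteq> 0}"
  shows "continuous_map T zariski_GL F"
  unfolding zariski_GL_def
proof (rule continuous_on_generated_topo)
  show "F ` topspace T \<subseteq> \<Union> (range (\<lambda>p. {A. invertible A \<and> eval_at id A p \<noteq> 0}))"
    using inv topspace_zariski_GL[where 'a = 'a and 'n = 'n]
    unfolding zariski_GL_def topology_generated_by_topspace by blast
  fix U :: "('a^'n^'n) set" assume "U \<in> range (\<lambda>p. {A. invertible A \<and> eval_at id A p \<noteq> 0})"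
  then obtain p where U: "U = {A. invertible A \<and> eval_at id A p \<noteq> 0}" by blast
  have "F -` U \<inter> topspace T = {x \<in> topspace T. eval_at id (F x) p \<noteq> 0}"
    unfolding U using inv by blast
  then show "openin T (F -` U \<inter> topspace T)"
    using opn by simp
qed

lemma continuous_map_zariski_GL_regular:
  fixes F :: "'a::field^'n^'n \<Rightarrow> 'a^'n^'n"
  assumes "\<And>A. invertible A \<Longrightarrow> invertible (F A)" "\<And>i j. regular_on_GL (\<lambda>A. F A $ i $ j)"
  shows "continuous_map zariski_GL zariski_GL F"
  using assms openin_zariski_GL_regular[OF regular_on_GL_compose[OF poly_fun_eval_at assms(2)]]
  by (intro continuous_map_zariski_GLI) (auto simp: topspace_zariski_GL)

abbreviation GL :: "('a::field^'n^'n) monoid"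
  where "GL \<equiv> matrix_group {A. invertible A}"

lemma matrix_group_simps [simp]:
  "carrier (matrix_group S) = S" "A \<otimes>\<^bsub>matrix_group S\<^esub> B = A ** B" "\<one>\<^bsub>matrix_group S\<^esub> = mat 1"
  by (simp_all add: matrix_group_def)

lemma group_GL: "group (GL :: ('a::field^'n^'n) monoid)"
proof (rule groupI)
  show "\<one>\<^bsub>GL\<^esub> \<in> carrier (GL :: ('a^'n^'n) monoid)"
    using invertible_def matrix_mul_lid by fastforce
  show "\<exists>y\<in>carrier GL. y \<otimes>\<^bsub>GL\<^esub> x = \<one>\<^bsub>GL\<^esub>" if "x \<in> carrier GL" for x :: "'a^'n^'n"
    using that by (auto intro!: exI[of _ "matrix_inv x"] simp: matrix_inv_left invertible_matrix_inv)
qed (auto simp: invertible_mult matrix_mul_assoc)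

lemma inv_matrix_group:
  fixes A :: "'a::semiring_1^'n^'n"
  assumes "group (matrix_group S)" "A \<in> S"
  shows "inv\<^bsub>matrix_group S\<^esub> A = matrix_inv A"
  using group.r_inv[OF assms(1)] group.l_inv[OF assms(1)] assms(2)
  by (intro matrix_inv_unique[symmetric]) auto

interpretation GL: conj_continuous_group "GL :: ('a::field^'n^'n) monoid" zariski_GL
proof -
  interpret group "GL :: ('a^'n^'n) monoid" by (rule group_GL)
  have inv: "inv\<^bsub>GL\<^esub> A = matrix_inv A" if "invertible A" for A :: "'a^'n^'n"
    using that by (simp add: inv_matrix_group group_GL)
  note regular = regular_on_GL_matrix_mult regular_on_GL_matrix_inv
    regular_on_GL_poly_fun[OF poly_fun.entry] regular_on_GL_poly_fun[OF poly_fun.const]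
  show "conj_continuous_group (GL :: ('a^'n^'n) monoid) zariski_GL"
  proof
    show "continuous_map zariski_GL zariski_GL (m_inv (GL :: ('a^'n^'n) monoid))"
      by (rule continuous_map_eq[OF continuous_map_zariski_GL_regular[of matrix_inv]])
        (auto simp: topspace_zariski_GL inv regular invertible_matrix_inv)
    fix a :: "'a^'n^'n" assume a: "a \<in> carrier GL"
    show "continuous_map zariski_GL zariski_GL (\<lambda>x. x \<otimes>\<^bsub>GL\<^esub> a \<otimes>\<^bsub>GL\<^esub> inv\<^bsub>GL\<^esub> x)"
      by (rule continuous_map_eq[OF continuous_map_zariski_GL_regular[of "\<lambda>x. x ** a ** matrix_inv x"]])
        (use a in \<open>auto simp: topspace_zariski_GL inv invertible_matrix_inv invertible_mult
          intro!: regular\<close>)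
  qed (auto simp: topspace_zariski_GL invertible_mult intro!: continuous_map_zariski_GL_regular regular)
qed

lemma vanishing_ideal_closure:
  assumes "S \<subseteq> {A. invertible A}"
  shows "vanishing_ideal (zariski_GL closure_of S) = vanishing_ideal S"
proof
  show "vanishing_ideal (zariski_GL closure_of S) \<subseteq> vanishing_ideal S"
    using GL.subset_closure[of S] assms by (auto simp: vanishing_ideal_def)
  show "vanishing_ideal S \<subseteq> vanishing_ideal (zariski_GL closure_of S)"
  proof (clarsimp simp: vanishing_ideal_def)
    fix p A assume p: "\<forall>A\<in>S. eval_at id A p = 0" and A: "A \<in> zariski_GL closure_of S"
    have "openin zariski_GL {A. invertible A \<and> eval_at id A p \<noteq> 0}"
      by (intro openin_zariski_GL_regular regular_on_GL_poly_fun poly_fun_eval_at)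
    moreover have "invertible A"
      using GL.closure_carrier[of S] A by auto
    ultimately show "eval_at id A p = 0"
      using A p unfolding in_closure_of by (metis (mono_tags, lifting) mem_Collect_eq)
  qed
qed

text \<open>
  Polynomials over \<open>K\<close> generate the vanishing ideal of a set of rational points, and passing to the
  Zariski closure does not change this ideal.
\<close>

lemma algebraic_K_group_closure:
  fixes D :: "('k::field^'n^'n) set"
  assumes "subgroup (extend_scalars ` D) GL"
  shows "algebraic_K_group (zariski_GL closure_of (extend_scalars ` D))"
  using GL.subgroup_closure[OF assms] subgroup.subset[OF assms] vanishing_ideal_rational_points[of D]
  by (simp add: algebraic_K_group_def linear_algebraic_group_def defined_over_base_def
      vanishing_ideal_closure)


section \<open>Rational points\<close>

lemma extend_scalars_nth [simp]: "extend_scalars A $ i $ j = to_ac (A $ i $ j)"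
  by (simp add: extend_scalars_def)

lemma extend_scalars_mult: "extend_scalars (A ** B) = extend_scalars A ** extend_scalars B"
  by (simp add: vec_eq_iff matrix_matrix_mult_def to_ac_sum)

lemma extend_scalars_one: "extend_scalars (mat 1) = mat 1"
  by (simp add: vec_eq_iff mat_def)

lemma extend_scalars_inj: "extend_scalars A = extend_scalars B \<longleftrightarrow> A = B"
  by (simp add: vec_eq_iff)

lemma det_extend_scalars: "det (extend_scalars A) = to_ac (det A)"
  by (simp add: det_def to_ac_sum to_ac_prod)

lemma invertible_extend_scalars: "invertible (extend_scalars A) \<longleftrightarrow> invertible A"
  by (simp add: invertible_det_nz det_extend_scalars)

lemma extend_scalars_matrix_inv:
  "invertible A \<Longrightarrow> extend_scalars (matrix_inv A) = matrix_inv (extend_scalars A)"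
  by (rule matrix_inv_unique[symmetric])
    (simp_all add: extend_scalars_one matrix_inv_left matrix_inv_right flip: extend_scalars_mult)

context
  fixes G :: "('k::field alg_closure^'n^'n) set"
  assumes G: "linear_algebraic_group G"
begin

lemma subgroup_GL: "subgroup G GL"
  using G by (simp add: linear_algebraic_group_def)

lemma group_linear_algebraic_group: "group (matrix_group G)"
  using subgroup.subgroup_is_group[OF subgroup_GL group_GL] by (simp add: matrix_group_def)

lemma invertible_rational_point: "extend_scalars A \<in> G \<Longrightarrow> invertible A"
  using subgroup.subset[OF subgroup_GL] by (auto simp: invertible_extend_scalars)

lemma matrix_inv_rational_point:
  assumes "extend_scalars A \<in> G"
  shows "extend_scalars (matrix_inv A) \<in> G"
proof -
  have "inv\<^bsub>GL\<^esub> (extend_scalars A) = matrix_inv (extend_scalars A)"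
    using subgroup.subset[OF subgroup_GL] assms by (intro inv_matrix_group group_GL) auto
  then show ?thesis
    using subgroup.m_inv_closed[OF subgroup_GL assms]
    by (simp add: extend_scalars_matrix_inv invertible_rational_point[OF assms])
qed

lemma group_rational_points: "group (rational_points G)"
  unfolding rational_points_def
proof (rule groupI)
  show "x \<otimes>\<^bsub>matrix_group {A. extend_scalars A \<in> G}\<^esub> y \<in> carrier (matrix_group {A. extend_scalars A \<in> G})"
    if "x \<in> carrier (matrix_group {A. extend_scalars A \<in> G})"
      "y \<in> carrier (matrix_group {A. extend_scalars A \<in> G})" for x y
    using that subgroup.m_closed[OF subgroup_GL] by (simp add: extend_scalars_mult)
  show "\<exists>y\<in>carrier (matrix_group {A. extend_scalars A \<in> G}).
      y \<otimes>\<^bsub>matrix_group {A. extend_scalars A \<in> G}\<^esub> x = \<one>\<^bsub>matrix_group {A. extend_scalars A \<in> G}\<^esub>"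
    if "x \<in> carrier (matrix_group {A. extend_scalars A \<in> G})" for x
    using that matrix_inv_rational_point[of x] invertible_rational_point[of x]
    by (auto intro!: exI[of _ "matrix_inv x"] simp: matrix_inv_left)
  show "\<one>\<^bsub>matrix_group {A. extend_scalars A \<in> G}\<^esub> \<in> carrier (matrix_group {A. extend_scalars A \<in> G})"
    using subgroup.one_closed[OF subgroup_GL] by (simp add: extend_scalars_one)
qed (simp_all add: matrix_mul_assoc)

lemma rational_points_simps:
  "carrier (rational_points G) = {A. extend_scalars A \<in> G}"
  "A \<otimes>\<^bsub>rational_points G\<^esub> B = A ** B"
  "\<one>\<^bsub>rational_points G\<^esub> = mat 1"
  by (simp_all add: rational_points_def)

lemma inv_rational_points:
  "extend_scalars A \<in> G \<Longrightarrow> inv\<^bsub>rational_points G\<^esub> A = matrix_inv A"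
  using inv_matrix_group[of "{A. extend_scalars A \<in> G}" A] group_rational_points
  by (simp add: rational_points_def)

lemma subgroup_extend_scalars_image:
  assumes "subgroup D (rational_points G)"
  shows "subgroup (extend_scalars ` D) GL" and "extend_scalars ` D \<subseteq> G"
proof -
  have D: "D \<subseteq> {A. extend_scalars A \<in> G}"
    using subgroup.subset[OF assms] by (simp add: rational_points_simps)
  show "extend_scalars ` D \<subseteq> G"
    using D by auto
  show "subgroup (extend_scalars ` D) GL"
  proof (rule subgroup.intro)
    show "extend_scalars ` D \<subseteq> carrier GL"
      using D invertible_rational_point by (auto simp: invertible_extend_scalars)
    show "\<one>\<^bsub>GL\<^esub> \<in> extend_scalars ` D"
      using subgroup.one_closed[OF assms] by (force simp: rational_points_simps extend_scalars_one)
    show "x \<otimes>\<^bsub>GL\<^esub> y \<in> extend_scalars ` D" if "x \<in> extend_scalars ` D" "y \<in> extend_scalars ` D" for x y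
      using that subgroup.m_closed[OF assms]
      by (force simp: rational_points_simps simp flip: extend_scalars_mult)
    show "inv\<^bsub>GL\<^esub> x \<in> extend_scalars ` D" if x: "x \<in> extend_scalars ` D" for x
    proof -
      obtain d where d: "d \<in> D" "x = extend_scalars d" using x by blast
      then have "invertible d" "extend_scalars d \<in> G"
        using D invertible_rational_point by auto
      then have "inv\<^bsub>GL\<^esub> x = extend_scalars (inv\<^bsub>rational_points G\<^esub> d)"
        using d by (simp add: inv_matrix_group group_GL invertible_extend_scalars
            extend_scalars_matrix_inv inv_rational_points)
      then show ?thesis
        using subgroup.m_inv_closed[OF assms d(1)] by blast
    qed
  qed
qed

end


section \<open>Matrices over a local field\<close>

lemma continuous_on_poly_fun:
  fixes \<phi> :: "'k::local_field^'n^'n \<Rightarrow> 'k"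
  shows "\<phi> \<in> poly_fun \<Longrightarrow> continuous_on S \<phi>"
  by (induction rule: poly_fun.induct) (intro continuous_intros; assumption)+

lemma continuous_on_matrixI:
  fixes F :: "'b::topological_space \<Rightarrow> 'a::topological_space^'n^'m"
  assumes "\<And>i j. continuous_on S (\<lambda>x. F x $ i $ j)"
  shows "continuous_on S F"
proof -
  have "continuous_on S (\<lambda>x. \<chi> i j. F x $ i $ j)"
    by (intro continuous_on_vec_lambda assms)
  then show ?thesis by simp
qed

lemma continuous_on_matrix_mult:
  fixes F H :: "'b::topological_space \<Rightarrow> 'k::local_field^'n^'n"
  assumes "continuous_on S F" "continuous_on S H"
  shows "continuous_on S (\<lambda>x. F x ** H x)"
proof (rule continuous_on_matrixI)
  fix i j
  show "continuous_on S (\<lambda>x. (F x ** H x) $ i $ j)"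
    unfolding matrix_matrix_mult_def vec_lambda_beta by (intro continuous_intros assms)
qed

lemma continuous_on_inverse_local_field:
  fixes g :: "'b::topological_space \<Rightarrow> 'k::local_field"
  assumes "continuous_on S g" "\<And>x. x \<in> S \<Longrightarrow> g x \<noteq> 0"
  shows "continuous_on S (\<lambda>x. inverse (g x))"
  using assms unfolding continuous_on_def
  by (auto intro: filterlim_compose[OF tendsto_inverse_nhds])

lemma continuous_on_matrix_inv:
  "continuous_on {A::'k::local_field^'n^'n. invertible A} matrix_inv"
proof (rule continuous_on_matrixI)
  fix i j :: 'n
  have "continuous_on {A::'k^'n^'n. invertible A} (\<lambda>A. cofactor_entry i j A * inverse (det A))"
    by (intro continuous_intros continuous_on_inverse_local_field continuous_on_poly_fun
        poly_fun_cofactor_entry poly_fun_det poly_fun.entry) (simp add: invertible_det_nz)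
  then show "continuous_on {A::'k^'n^'n. invertible A} (\<lambda>A. matrix_inv A $ i $ j)"
    by (rule continuous_on_eq) (simp add: matrix_inv_entry field_simps)
qed

lemma compact_vec_box:
  fixes C :: "'n::finite \<Rightarrow> 'a::topological_space set"
  assumes "\<And>i. compact (C i)"
  shows "compact {x :: 'a^'n. \<forall>i. x $ i \<in> C i}"
proof -
  have "compactin (product_topology (\<lambda>i. euclidean) UNIV) (Pi\<^sub>E UNIV C)"
    using assms by (simp add: compactin_PiE)
  then have "compact (Pi\<^sub>E UNIV C)"
    by (simp add: euclidean_product_topology)
  then have "compact ((\<lambda>f. \<chi> i. f i) ` Pi\<^sub>E UNIV C)"
    by (rule compact_continuous_image[rotated])
      (intro continuous_on_vec_lambda continuous_on_subset[OF continuous_on_product_coordinates] subset_UNIV)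
  also have "(\<lambda>f. \<chi> i. f i) ` Pi\<^sub>E UNIV C = {x :: 'a^'n. \<forall>i. x $ i \<in> C i}"
  proof (intro equalityI subsetI)
    fix x :: "'a^'n" assume "x \<in> {x. \<forall>i. x $ i \<in> C i}"
    then show "x \<in> (\<lambda>f. \<chi> i. f i) ` Pi\<^sub>E UNIV C"
      by (intro image_eqI[of _ _ "\<lambda>i. x $ i"]) auto
  qed auto
  finally show ?thesis .
qed

lemma compact_matrix_box:
  fixes C :: "'m::finite \<Rightarrow> 'n::finite \<Rightarrow> 'a::topological_space set"
  assumes "\<And>i j. compact (C i j)"
  shows "compact {A :: 'a^'n^'m. \<forall>i j. A $ i $ j \<in> C i j}"
  using compact_vec_box[of "\<lambda>i. {x :: 'a^'n. \<forall>j. x $ j \<in> C i j}"] compact_vec_box[of "C _"] assms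
  by simp

text \<open>
  A value in the algebraic closure is nonzero iff some \<open>K\<close>-functional does not kill it, and applying
  a \<open>K\<close>-functional to the value of a polynomial at a rational point gives a polynomial function over
  \<open>K\<close>. So a principal Zariski-open set meets \<open>GL\<^sub>n(K)\<close> in a union of non-vanishing loci over \<open>K\<close>.
\<close>

lemma continuous_map_extend_scalars:
  "continuous_map (top_of_set {A::'k::local_field^'n^'n. invertible A}) zariski_GL extend_scalars"
proof (rule continuous_map_zariski_GLI)
  fix p :: "('k alg_closure, 'n) matrix_poly"
  have "(\<exists>\<pi>. K_functional \<pi> \<and> eval_at id A (Poly_Mapping.map \<pi> p) \<noteq> 0) \<longleftrightarrow>
      eval_at id (extend_scalars A) p \<noteq> 0" for A :: "'k^'n^'n"
    using ex_K_functional[of "eval_at id (extend_scalars A) p"]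
    by (force simp: K_functional_zero simp flip: K_functional_eval_at)
  then have eq: "{A \<in> topspace (top_of_set {A::'k^'n^'n. invertible A}). eval_at id (extend_scalars A) p \<noteq> 0} =
      {A. invertible A} \<inter> (\<Union>\<pi>\<in>Collect K_functional. {A. eval_at id A (Poly_Mapping.map \<pi> p) \<noteq> 0})"
    by auto
  have "open {A :: 'k^'n^'n. eval_at id A q \<noteq> 0}" for q
    by (intro open_Collect_neq continuous_on_poly_fun poly_fun_eval_at continuous_on_const)
  then show "openin (top_of_set {A::'k^'n^'n. invertible A})
      {A \<in> topspace (top_of_set {A. invertible A}). eval_at id (extend_scalars A) p \<noteq> 0}"
    unfolding eq by (intro openin_open_Int open_UN) auto
qed (simp add: invertible_extend_scalars)

text \<open>
  The rational points are closed in \<open>GL\<^sub>n(K)\<close> but in general not among all matrices, so the compact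
  set has to consist of invertible matrices.
\<close>

lemma compact_rational_points:
  fixes G :: "('k::local_field alg_closure^'n^'n) set"
  assumes "closedin zariski_GL G" "compact P" "P \<subseteq> {A. invertible A}"
  shows "compact (P \<inter> {A. extend_scalars A \<in> G})"
proof -
  have "closedin (top_of_set {A::'k^'n^'n. invertible A}) {A \<in> {A. invertible A}. extend_scalars A \<in> G}"
    using closedin_continuous_map_preimage[OF continuous_map_extend_scalars assms(1)] by simp
  then obtain T where "closed T" "{A \<in> {A. invertible A}. extend_scalars A \<in> G} = {A. invertible A} \<inter> T"
    by (auto simp: closedin_closed)
  then have "P \<inter> {A. extend_scalars A \<in> G} = P \<inter> T"
    using assms(3) by blast
  then show ?thesis
    using compact_Int_closed[OF assms(2) \<open>closed T\<close>] by simp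
qed

lemma bounded_in_rational_points_iff:
  "bounded_in (rational_points G) S \<longleftrightarrow> (\<exists>C. compact C \<and> C \<subseteq> {A. extend_scalars A \<in> G} \<and> S \<subseteq> C)"
  by (auto simp: bounded_in_def compactin_subtopology rational_points_def)

lemma bornological_group_rational_points:
  fixes G :: "('k::local_field alg_closure^'n^'n) set"
  assumes G: "linear_algebraic_group G"
  shows "bornological_group (rational_points G) (bounded_in (rational_points G))"
proof -
  interpret H: group "rational_points G" by (rule group_rational_points[OF G])
  note simps = rational_points_simps[OF G] inv_rational_points[OF G]
  show ?thesis
  proof
    show "bounded_in (rational_points G) T" if "bounded_in (rational_points G) S" "T \<subseteq> S" for S T
      using that by (auto simp: bounded_in_rational_points_iff)
    show "bounded_in (rational_points G) {h}" if "h \<in> carrier (rational_points G)" for h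
      using that by (auto simp: bounded_in_rational_points_iff simps intro!: exI[of _ "{h}"])
  next
    fix S T assume "bounded_in (rational_points G) S" "bounded_in (rational_points G) T"
    then obtain C D where C: "compact C" "C \<subseteq> carrier (rational_points G)" "S \<subseteq> C"
      and D: "compact D" "D \<subseteq> carrier (rational_points G)" "T \<subseteq> D"
      by (auto simp: bounded_in_rational_points_iff simps)
    have "compact ((\<lambda>x. fst x ** snd x) ` (C \<times> D))"
      by (intro compact_continuous_image compact_Times C D continuous_on_matrix_mult continuous_intros)
    moreover have "(\<lambda>x. fst x ** snd x) ` (C \<times> D) \<subseteq> carrier (rational_points G)"
      using C D H.m_closed by (force simp: simps)
    moreover have "S <#>\<^bsub>rational_points G\<^esub> T \<subseteq> (\<lambda>x. fst x ** snd x) ` (C \<times> D)"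
      using C D by (force simp: set_mult_def simps)
    ultimately show "bounded_in (rational_points G) (S <#>\<^bsub>rational_points G\<^esub> T)"
      unfolding bounded_in_rational_points_iff simps by blast
  next
    fix S assume "bounded_in (rational_points G) S"
    then obtain C where C: "compact C" "C \<subseteq> carrier (rational_points G)" "S \<subseteq> C"
      by (auto simp: bounded_in_rational_points_iff simps)
    have "compact (matrix_inv ` C)"
      using C invertible_rational_point[OF G]
      by (intro compact_continuous_image continuous_on_subset[OF continuous_on_matrix_inv]) (auto simp: simps)
    moreover have "matrix_inv ` C \<subseteq> {A. extend_scalars A \<in> G}"
      using C matrix_inv_rational_point[OF G] by (auto simp: simps)
    moreover have "m_inv (rational_points G) ` S \<subseteq> matrix_inv ` C"
      using C inv_rational_points[OF G] by (force simp: simps)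
    ultimately show "bounded_in (rational_points G) (m_inv (rational_points G) ` S)"
      unfolding bounded_in_rational_points_iff by blast
  qed
qed


section \<open>Bounded families in the algebraic closure\<close>

text \<open>
  Families in the algebraic closure that stay in a bounded part of a finite-dimensional \<open>K\<close>-subspace.
  This notion of boundedness needs no topology on the algebraic closure.
\<close>

inductive_set bounded_family :: "'i set \<Rightarrow> ('i \<Rightarrow> 'k::local_field alg_closure) set"
  for I where
  scaled: "compact C \<Longrightarrow> u ` I \<subseteq> C \<Longrightarrow> (\<lambda>x. c * to_ac (u x)) \<in> bounded_family I"
| add: "\<phi> \<in> bounded_family I \<Longrightarrow> \<psi> \<in> bounded_family I \<Longrightarrow> (\<lambda>x. \<phi> x + \<psi> x) \<in> bounded_family I"

lemma bounded_family_to_ac: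
  "compact C \<Longrightarrow> u ` I \<subseteq> C \<Longrightarrow> (\<lambda>x. to_ac (u x)) \<in> bounded_family I"
  using bounded_family.scaled[of C u I 1] by simp

lemma bounded_family_const: "(\<lambda>x. c) \<in> bounded_family I"
  using bounded_family.scaled[of "{1}" "\<lambda>_. 1" I c] by auto

lemma compact_times:
  fixes C D :: "'k::local_field set"
  assumes "compact C" "compact D"
  shows "compact ((\<lambda>x. fst x * snd x) ` (C \<times> D))"
  by (intro compact_continuous_image compact_Times assms continuous_intros)

lemma compact_plus:
  fixes C D :: "'k::local_field set"
  assumes "compact C" "compact D"
  shows "compact ((\<lambda>x. fst x + snd x) ` (C \<times> D))"
  by (intro compact_continuous_image compact_Times assms continuous_intros)

lemma bounded_family_mult:
  assumes "\<phi> \<in> bounded_family I" "\<psi> \<in> bounded_family I"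
  shows "(\<lambda>x. \<phi> x * \<psi> x) \<in> bounded_family I"
  using assms(1)
proof induction
  case (scaled C u c)
  show ?case
    using assms(2)
  proof induction
    case (scaled D v d)
    have "(\<lambda>x. (c * d) * to_ac (u x * v x)) \<in> bounded_family I"
      using \<open>u ` I \<subseteq> C\<close> scaled
      by (intro bounded_family.scaled[OF compact_times[OF \<open>compact C\<close> \<open>compact D\<close>]]) force
    then show ?case by (simp add: mult_ac)
  qed (simp add: distrib_left bounded_family.add)
qed (simp add: distrib_right bounded_family.add)

lemma K_functional_bounded_family:
  assumes "\<phi> \<in> bounded_family I" and \<pi>: "K_functional \<pi>"
  shows "\<exists>C. compact C \<and> (\<lambda>x. \<pi> (\<phi> x)) ` I \<subseteq> C"
  using assms(1)
proof induction
  case (scaled C u c)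
  have "\<pi> (c * to_ac (u x)) = u x * \<pi> c" for x
    using K_functional_scale[OF \<pi>, of "u x" c] by (simp add: mult.commute)
  then show ?case
    using scaled by (intro exI[of _ "(\<lambda>x. fst x * snd x) ` (C \<times> {\<pi> c})"])
      (force intro!: compact_times)
next
  case (add \<phi> \<psi>)
  then obtain C D where "compact C" "(\<lambda>x. \<pi> (\<phi> x)) ` I \<subseteq> C" "compact D" "(\<lambda>x. \<pi> (\<psi> x)) ` I \<subseteq> D"
    by blast
  then show ?case
    by (intro exI[of _ "(\<lambda>x. fst x + snd x) ` (C \<times> D)"])
      (force intro!: compact_plus simp: K_functional_add[OF \<pi>])
qed

text \<open>
  A \<open>K\<close>-linear retraction of the algebraic closure onto \<open>K\<close> keeps such a family in a compact set and
  fixes the values that already lie in \<open>K\<close>.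
\<close>

lemma bounded_family_descends:
  assumes "\<phi> \<in> bounded_family I" "\<And>x. x \<in> I \<Longrightarrow> \<phi> x = to_ac (u x)"
  shows "\<exists>C. compact C \<and> u ` I \<subseteq> C"
proof -
  obtain \<pi> :: "'b alg_closure \<Rightarrow> 'b" where \<pi>: "K_functional \<pi>" "\<pi> 1 = 1"
    using ex_K_functional[of 1] by auto
  have "(\<lambda>x. \<pi> (\<phi> x)) ` I = u ` I"
    using assms(2) K_functional_to_ac[OF \<pi>] by (intro image_cong) auto
  then show ?thesis
    using K_functional_bounded_family[OF assms(1) \<pi>(1)] by simp
qed


section \<open>The Lie algebra and the adjoint representation\<close>

definition matrix_scale :: "'a::times \<Rightarrow> 'a^'n^'m \<Rightarrow> 'a^'n^'m"
  where "matrix_scale c A = (\<chi> i j. c * A $ i $ j)"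

interpretation matrix: vector_space "matrix_scale :: 'a::field \<Rightarrow> 'a^'n^'m \<Rightarrow> _"
  by unfold_locales (simp_all add: matrix_scale_def vec_eq_iff algebra_simps)

text \<open>
  A linear functional on matrices is a polynomial that equals its own differential. If it vanishes on
  \<open>S\<close>, it therefore lies in the vanishing ideal of \<open>G\<close> and kills the tangent space at the identity.
\<close>

lemma lie_algebra_subset_span:
  fixes G S :: "('a::field^'n^'n) set"
  assumes "vanishing_ideal S \<subseteq> vanishing_ideal G"
  shows "lie_algebra G \<subseteq> matrix.span S"
proof (rule subsetI, rule ccontr)
  fix Y assume Y: "Y \<in> lie_algebra G" "Y \<notin> matrix.span S"
  obtain \<phi> :: "'a^'n^'n \<Rightarrow> 'a" where add: "\<And>A B. \<phi> (A + B) = \<phi> A + \<phi> B"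
    and scale: "\<And>c A. \<phi> (matrix_scale c A) = c * \<phi> A"
    and \<phi>: "\<phi> Y = 1" "\<And>A. A \<in> S \<Longrightarrow> \<phi> A = 0"
    using matrix.separating_functional[OF Y(2)] by blast
  \<comment> \<open>\<open>E\<close> are the matrix units, and \<open>p\<close> is \<open>\<phi>\<close> written as a polynomial in the entries\<close>
  define E :: "'n \<times> 'n \<Rightarrow> 'a^'n^'n" where "E x = (\<chi> i j. if x = (i, j) then 1 else 0)" for x
  define p where "p = (\<Sum>x\<in>UNIV. Poly_Mapping.single (Poly_Mapping.single x (1::nat)) (\<phi> (E x)))"
  have \<phi>_sum: "\<phi> (sum g J) = (\<Sum>x\<in>J. \<phi> (g x))" for g and J :: "('n \<times> 'n) set"
    using scale[of 0 0] by (induction J rule: infinite_finite_induct) (auto simp: add matrix_scale_def zero_vec_def)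
  have \<phi>_eq: "\<phi> A = (\<Sum>x\<in>UNIV. \<phi> (E x) * A $ fst x $ snd x)" for A
  proof -
    have "A = (\<Sum>x\<in>UNIV. matrix_scale (A $ fst x $ snd x) (E x))"
      by (simp add: vec_eq_iff matrix_scale_def E_def if_distrib[of "\<lambda>z. _ * z"] cong: if_cong)
    then have "\<phi> A = \<phi> (\<Sum>x\<in>UNIV. matrix_scale (A $ fst x $ snd x) (E x))"
      by simp
    then show ?thesis
      by (simp add: \<phi>_sum scale mult.commute)
  qed
  have eval_p: "eval_at h A p = (\<Sum>x\<in>UNIV. h (\<phi> (E x)) * A $ fst x $ snd x)"
    if "h 0 = 0" "\<And>a b. h (a + b) = h a + h b" for h :: "'a \<Rightarrow> 'b::comm_semiring_1" and A
  proof -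
    have "monomial_at A (Poly_Mapping.single x 1) = A $ fst x $ snd x" for x :: "'n \<times> 'n"
      using monomial_at_single[of A "fst x" "snd x"] by simp
    then show ?thesis
      by (simp add: p_def eval_at_sum[of h, OF that] eval_at_single[of h, OF that(1)])
  qed
  have "p \<in> vanishing_ideal S"
    using \<phi>(2) by (simp add: vanishing_ideal_def eval_p flip: \<phi>_eq)
  then have "p \<in> vanishing_ideal G"
    using assms by blast
  then have "Polynomial.coeff
      (eval_at (\<lambda>c. [:c:]) (\<chi> i j. [:(mat 1 :: 'a^'n^'n) $ i $ j, Y $ i $ j:]) p) 1 = 0"
    using Y(1) unfolding lie_algebra_def by blast
  moreover have "Polynomial.coeff
      (eval_at (\<lambda>c. [:c:]) (\<chi> i j. [:(mat 1 :: 'a^'n^'n) $ i $ j, Y $ i $ j:]) p) 1 = \<phi> Y"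
    by (simp add: eval_p coeff_sum \<phi>_eq[of Y] mult_ac)
  ultimately show False
    using \<phi>(1) by simp
qed

lemma bounded_family_sandwich:
  fixes F F' :: "'i \<Rightarrow> 'k::local_field alg_closure^'n^'n"
  assumes "Y \<in> matrix.span S"
    and "\<And>A i j. A \<in> S \<Longrightarrow> (\<lambda>z. (F z ** A ** F' z) $ i $ j) \<in> bounded_family I"
  shows "(\<lambda>z. (F z ** Y ** F' z) $ i $ j) \<in> bounded_family I"
  using assms(1)
proof (induction rule: matrix.span_induct_alt)
  case base
  show ?case
    by (simp add: matrix_matrix_mult_def bounded_family_const)
next
  case (step c A B)
  have "(M ** (matrix_scale c A + B) ** M') $ i $ j = c * (M ** A ** M') $ i $ j + (M ** B ** M') $ i $ j"
    for M M' :: "'k alg_closure^'n^'n"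
    by (simp add: matrix_matrix_mult_def matrix_scale_def sum_distrib_left sum_distrib_right sum.distrib algebra_simps)
  then show ?case
    using step assms(2) by (simp add: bounded_family.add bounded_family_mult bounded_family_const)
qed

lemma bounded_family_Ad_regular:
  fixes F :: "'i \<Rightarrow> 'k::local_field alg_closure^'n^'n"
  assumes "\<psi> \<in> Ad_regular_functions G"
    and "\<And>Y i j. Y \<in> lie_algebra G \<Longrightarrow> (\<lambda>z. Ad (F z) Y $ i $ j) \<in> bounded_family I"
    and "\<And>Y i j. Y \<in> lie_algebra G \<Longrightarrow> (\<lambda>z. Ad (matrix_inv (F z)) Y $ i $ j) \<in> bounded_family I"
  shows "(\<lambda>z. \<psi> (F z)) \<in> bounded_family I"
  using assms(1)
  by induction (simp_all add: assms(2,3) bounded_family_const bounded_family.add bounded_family_mult)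

text \<open>
  Bounds on the entries alone would allow limits outside \<open>GL\<^sub>n\<close>. The bound on the regular function
  \<open>1 / det\<close> excludes this.
\<close>

lemma bounded_in_if_regular_bounded:
  fixes G :: "('k::local_field alg_closure^'n^'n) set" and F :: "'i \<Rightarrow> 'k^'n^'n"
  assumes G: "linear_algebraic_group G"
    and F: "\<And>z. z \<in> I \<Longrightarrow> extend_scalars (F z) \<in> G"
    and bdd: "\<And>\<phi>. regular_function_on G \<phi> \<Longrightarrow>
      \<exists>\<psi>\<in>bounded_family I. \<forall>z\<in>I. \<phi> (extend_scalars (F z)) = \<psi> z"
  shows "bounded_in (rational_points G) (F ` I)"
proof -
  have "\<exists>C. compact C \<and> (\<lambda>z. F z $ i $ j) ` I \<subseteq> C" for i j
  proof -
    obtain p where "\<forall>A. A $ i $ j = eval_at id A (p :: ('k alg_closure, 'n) matrix_poly)"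
      using ex_poly_of_poly_fun[OF poly_fun.entry[of i j]] by blast
    then have "regular_function_on G (\<lambda>A. A $ i $ j)"
      unfolding regular_function_on_def by (intro exI[of _ p] exI[of _ 0]) simp
    then obtain \<psi> where "\<psi> \<in> bounded_family I" "\<forall>z\<in>I. extend_scalars (F z) $ i $ j = \<psi> z"
      using bdd by blast
    then show ?thesis
      by (intro bounded_family_descends) auto
  qed
  then obtain C where C: "\<And>i j. compact (C i j)" "\<And>i j. (\<lambda>z. F z $ i $ j) ` I \<subseteq> C i j"
    by metis
  have "regular_function_on G (\<lambda>A. 1 / det A)"
    unfolding regular_function_on_def
    by (rule exI[of _ "Poly_Mapping.single 0 1"], rule exI[of _ 1]) (subst eval_at_single; simp)
  then obtain \<psi> where \<psi>: "\<psi> \<in> bounded_family I" "\<forall>z\<in>I. 1 / det (extend_scalars (F z)) = \<psi> z"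
    using bdd by blast
  have "\<exists>E. compact E \<and> (\<lambda>z. 1 / det (F z)) ` I \<subseteq> E"
    by (rule bounded_family_descends[OF \<psi>(1)]) (use \<psi>(2) in \<open>auto simp: det_extend_scalars\<close>)
  then obtain E where E: "compact E" "(\<lambda>z. 1 / det (F z)) ` I \<subseteq> E"
    by blast
  \<comment> \<open>pairing a matrix with the inverse of its determinant turns invertibility into a closed condition\<close>
  define P where "P = fst ` (({A :: 'k^'n^'n. \<forall>i j. A $ i $ j \<in> C i j} \<times> E) \<inter> {x. det (fst x) * snd x = 1})"
  have "continuous_on UNIV (det :: 'k^'n^'n \<Rightarrow> 'k)"
    by (intro continuous_on_poly_fun poly_fun_det poly_fun.entry)
  then have "continuous_on UNIV (\<lambda>x :: ('k^'n^'n) \<times> 'k. det (fst x) * snd x)"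
    by (intro continuous_intros continuous_on_compose2[of UNIV det _ fst]) auto
  then have "closed {x :: ('k^'n^'n) \<times> 'k. det (fst x) * snd x = 1}"
    by (intro closed_Collect_eq continuous_on_const)
  then have "compact P"
    unfolding P_def
    by (intro compact_continuous_image compact_Int_closed compact_Times compact_matrix_box C E
        continuous_on_fst continuous_on_id)
  moreover have "P \<subseteq> {A. invertible A}"
    by (auto simp: P_def invertible_det_nz)
  ultimately have "compact (P \<inter> {A. extend_scalars A \<in> G})"
    using G by (intro compact_rational_points) (auto simp: linear_algebraic_group_def)
  moreover have "F ` I \<subseteq> P \<inter> {A. extend_scalars A \<in> G}"
  proof safe
    fix z assume z: "z \<in> I"
    then show "extend_scalars (F z) \<in> G" by (rule F)
    then have "det (F z) \<noteq> 0"
      using invertible_rational_point[OF G] invertible_det_nz by blast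
    then show "F z \<in> P"
      unfolding P_def using z C(2) E(2) by (intro image_eqI[of _ _ "(F z, 1 / det (F z))"]) auto
  qed
  ultimately show ?thesis
    unfolding bounded_in_rational_points_iff by blast
qed

text \<open>
  The Lie algebra lies in the linear span of \<open>S\<close>, so the bounds on the conjugates of \<open>S\<close> give bounds on
  the adjoint action in both directions. As the group is adjoint, all regular functions are polynomials
  in the matrix coefficients of this action, so they are bounded as well.
\<close>

lemma bounded_in_if_conj_bounded:
  fixes G :: "('k::local_field alg_closure^'n^'n) set" and F :: "'i \<Rightarrow> 'k^'n^'n"
  assumes G: "linear_algebraic_group G" "adjoint_group G"
    and F: "\<And>z. z \<in> I \<Longrightarrow> extend_scalars (F z) \<in> G"
    and S: "vanishing_ideal (extend_scalars ` S) \<subseteq> vanishing_ideal G"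
    and conj: "\<And>s. s \<in> S \<Longrightarrow> bounded_in (rational_points G) ((\<lambda>z. F z ** s ** matrix_inv (F z)) ` I)"
    and conj_inv: "\<And>s. s \<in> S \<Longrightarrow> bounded_in (rational_points G) ((\<lambda>z. matrix_inv (F z) ** s ** F z) ` I)"
  shows "bounded_in (rational_points G) (F ` I)"
proof (rule bounded_in_if_regular_bounded[OF G(1) F])
  fix \<phi> assume "regular_function_on G \<phi>"
  then obtain \<psi> where \<psi>: "\<psi> \<in> Ad_regular_functions G" "\<forall>A\<in>G. \<phi> A = \<psi> A"
    using G(2) unfolding adjoint_group_def by blast
  \<comment> \<open>the default outside \<open>I\<close> keeps every member of the family invertible\<close>
  define F' where "F' z = (if z \<in> I then F z else mat 1)" for z
  have inv: "invertible (F' z)" for z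
    using F invertible_rational_point[OF G(1)] by (simp add: F'_def invertible_det_nz)
  have entry: "(\<lambda>z. extend_scalars (M z) $ i $ j) \<in> bounded_family I"
    if "bounded_in (rational_points G) (M ` I)" for M :: "'i \<Rightarrow> 'k^'n^'n" and i j
  proof -
    obtain C where C: "compact C" "M ` I \<subseteq> C"
      using \<open>bounded_in _ _\<close> by (auto simp: bounded_in_rational_points_iff)
    have "compact ((\<lambda>A. A $ i $ j) ` C)"
      by (intro compact_continuous_image C continuous_intros)
    then show ?thesis
      unfolding extend_scalars_nth by (rule bounded_family_to_ac) (use C(2) in auto)
  qed
  have conj': "(\<lambda>z. (extend_scalars (F' z) ** A ** matrix_inv (extend_scalars (F' z))) $ i $ j) \<in> bounded_family I"
    and conj_inv': "(\<lambda>z. (matrix_inv (extend_scalars (F' z)) ** A ** extend_scalars (F' z)) $ i $ j) \<in> bounded_family I"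
    if A: "A \<in> extend_scalars ` S" for A i j
  proof -
    obtain s where s: "s \<in> S" "A = extend_scalars s" using A by blast
    have "(\<lambda>z. F' z ** s ** matrix_inv (F' z)) ` I = (\<lambda>z. F z ** s ** matrix_inv (F z)) ` I"
      "(\<lambda>z. matrix_inv (F' z) ** s ** F' z) ` I = (\<lambda>z. matrix_inv (F z) ** s ** F z) ` I"
      by (simp_all add: F'_def cong: image_cong_simp)
    then show "(\<lambda>z. (extend_scalars (F' z) ** A ** matrix_inv (extend_scalars (F' z))) $ i $ j) \<in> bounded_family I"
      "(\<lambda>z. (matrix_inv (extend_scalars (F' z)) ** A ** extend_scalars (F' z)) $ i $ j) \<in> bounded_family I"
      using entry[of "\<lambda>z. F' z ** s ** matrix_inv (F' z)" i j] conj[OF s(1)]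
        entry[of "\<lambda>z. matrix_inv (F' z) ** s ** F' z" i j] conj_inv[OF s(1)]
      by (simp_all add: s(2) extend_scalars_mult extend_scalars_matrix_inv inv del: extend_scalars_nth)
  qed
  have inv_inv: "matrix_inv (matrix_inv A) = A" if "invertible A" for A :: "'k alg_closure^'n^'n"
    using that by (intro matrix_inv_unique) (simp_all add: matrix_inv_left matrix_inv_right)
  have "(\<lambda>z. \<psi> (extend_scalars (F' z))) \<in> bounded_family I"
  proof (rule bounded_family_Ad_regular[OF \<psi>(1)])
    fix Y i j assume "Y \<in> lie_algebra G"
    then have Y: "Y \<in> matrix.span (extend_scalars ` S)"
      using lie_algebra_subset_span[OF S] by blast
    show "(\<lambda>z. Ad (extend_scalars (F' z)) Y $ i $ j) \<in> bounded_family I"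
      unfolding Ad_def by (rule bounded_family_sandwich[OF Y conj'])
    show "(\<lambda>z. Ad (matrix_inv (extend_scalars (F' z))) Y $ i $ j) \<in> bounded_family I"
      unfolding Ad_def inv_inv[OF iffD2[OF invertible_extend_scalars inv]]
      by (rule bounded_family_sandwich[OF Y conj_inv'])
  qed
  then show "\<exists>\<psi>\<in>bounded_family I. \<forall>z\<in>I. \<phi> (extend_scalars (F z)) = \<psi> z"
    by (rule bexI[rotated]) (use F \<psi>(2) in \<open>simp add: F'_def\<close>)
qed

section \<open>Quasihomomorphisms into adjoint simple groups\<close>


theorem theorem4:
  fixes G :: "('k::local_field alg_closure^'n^'n) set"
    and \<Gamma> :: "('g, 'm) monoid_scheme"
    and f :: "'g \<Rightarrow> 'k^'n^'n"
  assumes "algebraic_K_group G"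
    and "connectedin zariski_GL G"
    and "simple_K_group G"
    and "adjoint_group G"
    and "group \<Gamma>"
    and "quasihomomorphism \<Gamma> (rational_points G) f"
    and "\<not> bounded_in (rational_points G) (f ` carrier \<Gamma>)"
    and "zariski_dense_in (generate (rational_points G) (f ` carrier \<Gamma>)) G"
  shows "f \<in> hom \<Gamma> (rational_points G)"
proof -
  let ?H = "rational_points G"
  have G: "linear_algebraic_group G"
    using assms(1) by (simp add: algebraic_K_group_def)
  note H_simps = rational_points_simps[OF G] inv_rational_points[OF G]
  interpret bornological_quasihomomorphism \<Gamma> ?H f "bounded_in ?H"
    using bornological_group_rational_points[OF G] assms(5,6) group_rational_points[OF G]
    by (simp add: bornological_quasihomomorphism_def group_valued_map_def group_valued_map_axioms_def
        bornological_quasihomomorphism_axioms_def quasihomomorphism_def)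
  let ?\<Delta> = "extend_scalars ` defect_group" and ?\<Lambda> = "generate ?H (f ` carrier \<Gamma>)"
  \<comment> \<open>the Zariski closure of the defect group will be a normal subgroup defined over \<open>K\<close>\<close>
  define N where "N = zariski_GL closure_of ?\<Delta>"
  note \<Delta> = subgroup_extend_scalars_image[OF G defect_group_subgroup]
  have \<Lambda>_sub: "?\<Lambda> \<subseteq> {A. extend_scalars A \<in> G}"
    using H.generate_incl[OF funcset_image[OF f_closed]] by (simp add: H_simps)
  have G_sub: "G \<subseteq> {A. invertible A}"
    using subgroup.subset[OF subgroup_GL[OF G]] by simp
  have \<Delta>_N: "?\<Delta> \<subseteq> N"
    unfolding N_def using \<Delta>(2) G_sub by (intro GL.subset_closure) auto
  have N: "algebraic_K_group N"
    unfolding N_def by (rule algebraic_K_group_closure[OF \<Delta>(1)])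
  have N_G: "N \<subseteq> G"
    unfolding N_def using G \<Delta>(2) by (intro closure_of_minimal) (auto simp: linear_algebraic_group_def)
  have "N \<lhd> matrix_group G"
  proof (rule group.normal_invI[OF group_linear_algebraic_group[OF G]])
    show "subgroup N (matrix_group G)"
      using group.subgroup_incl[OF group_GL _ subgroup_GL[OF G] N_G] N
      by (simp add: algebraic_K_group_def linear_algebraic_group_def matrix_group_def)
    fix g h assume g: "g \<in> carrier (matrix_group G)" and h: "h \<in> N"
    have "g \<otimes>\<^bsub>GL\<^esub> h \<otimes>\<^bsub>GL\<^esub> inv\<^bsub>GL\<^esub> g \<in> N"
      unfolding N_def
    proof (rule GL.closure_normalizes_closure)
      show "g \<in> zariski_GL closure_of (extend_scalars ` ?\<Lambda>)"
        using g assms(8) by (auto simp: zariski_dense_in_def)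
      show "h \<in> zariski_GL closure_of ?\<Delta>"
        using h by (simp add: N_def)
      show "extend_scalars ` ?\<Lambda> \<subseteq> carrier GL" "?\<Delta> \<subseteq> carrier GL"
        using \<Lambda>_sub \<Delta>(2) G_sub by auto
      fix l d assume "l \<in> extend_scalars ` ?\<Lambda>" "d \<in> ?\<Delta>"
      then obtain l' d' where ld: "l' \<in> ?\<Lambda>" "l = extend_scalars l'" "d' \<in> defect_group" "d = extend_scalars d'"
        by blast
      have l': "extend_scalars l' \<in> G" "invertible l'"
        using \<Lambda>_sub ld(1) invertible_rational_point[OF G] by auto
      have "l \<otimes>\<^bsub>GL\<^esub> d \<otimes>\<^bsub>GL\<^esub> inv\<^bsub>GL\<^esub> l = extend_scalars (l' ** d' ** matrix_inv l')"
        using l' by (simp add: ld inv_matrix_group group_GL invertible_extend_scalars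
            extend_scalars_matrix_inv extend_scalars_mult)
      then show "l \<otimes>\<^bsub>GL\<^esub> d \<otimes>\<^bsub>GL\<^esub> inv\<^bsub>GL\<^esub> l \<in> ?\<Delta>"
        using image_group_normalizes_defect_group[OF ld(1,3)] l' by (simp add: H_simps)
    qed
    moreover have "inv\<^bsub>GL\<^esub> g = inv\<^bsub>matrix_group G\<^esub> g"
      using g G_sub by (simp add: inv_matrix_group group_GL group_linear_algebraic_group[OF G] subset_iff)
    ultimately show "g \<otimes>\<^bsub>matrix_group G\<^esub> h \<otimes>\<^bsub>matrix_group G\<^esub> inv\<^bsub>matrix_group G\<^esub> g \<in> N"
      by simp
  qed
  then consider "N = {mat 1}" | "N = G"
    using assms(3) N unfolding simple_K_group_def by blast
  then show ?thesis
  proof cases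
    case 1
    have "d = mat 1" if "d \<in> defect_set \<Gamma> ?H f" for d
    proof -
      have "extend_scalars d = extend_scalars (mat 1)"
        using \<Delta>_N generate.incl[OF that, of ?H] by (auto simp: 1 extend_scalars_one)
      then show ?thesis
        by (simp only: extend_scalars_inj)
    qed
    then show ?thesis
      by (intro hom_if_trivial_defect) (auto simp: H_simps)
  next
    case 2
    \<comment> \<open>the defect group is Zariski dense, so conjugating it boundedly forces \<open>f\<close> to be bounded\<close>
    have f_G: "extend_scalars (f z) \<in> G" if "z \<in> carrier \<Gamma>" for z
      using f_in[OF that] by (simp add: H_simps)
    have "vanishing_ideal ?\<Delta> = vanishing_ideal G"
      using vanishing_ideal_closure[of ?\<Delta>] \<Delta>(2) G_sub 2 by (auto simp: N_def)
    then have "bounded_in ?H (f ` carrier \<Gamma>)"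
      using bounded_conj bounded_conj_inverse f_G
      by (intro bounded_in_if_conj_bounded[OF G assms(4), of "carrier \<Gamma>" f defect_group])
        (simp_all add: H_simps cong: image_cong_simp)
    then show ?thesis
      using assms(7) by contradiction
  qed
qed

end
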